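(* Let $G$ be an amenable unimodular lcsc group with Haar measure $m_G$, and let $(D_n)$ be a sequence of pre-compact Borel subsets of $G$ of positive Haar measure such that $\lim_{n\to\infty}m_G(CD_n)/m_G(D_n)=1$ for every compact $C\subset G$. If $P_o\subset G$ is uniformly discrete and has positive upper density with respect to $(D_n)$, i.e. $\varlimsup_{n\to\infty}\frac{|P_o\cap D_n|}{m_G(D_n)}>0$, then $P_o$ is measured, i.e. its hull $X(P_o)$ admits a $G$-invariant Borel probability measure.
   Context: $P_o\subset G$ is uniformly discrete if $e_G$ is not an accumulation point of $P_oP_o^{-1}$. The space $\mathcal C(G)$ of closed subsets of $G$ carries the compact metrizable Chabauty–Fell topology (generated by the sets $\{P\mid P\cap K=\emptyset\}$, $K$ compact, and $\{P\mid P\cap U\neq\emptyset\}$, $U$ open), and $G$ acts on it by $g.P=Pg^{-1}$. The hull $X(P_o)$ is the closure of the $G$-orbit of $P_o$ in $\mathcal C(G)$ with the point $\emptyset$ removed. *)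

theory Defs
  imports "HOL-Analysis.Analysis" "HOL-Probability.Probability_Measure"
begin

text \<open>
  Topological groups are the library's type class \<open>topological_group_add\<close>. Despite the additive
  notation this class is not commutative: \<open>x + y\<close> stands for the product \<open>xy\<close>, \<open>- x\<close> for the
  inverse, \<open>x - y = x + (- y)\<close> for \<open>xy\<^sup>-\<^sup>1\<close> and \<open>0\<close> for the neutral element.
\<close>

section \<open>Haar measure, unimodularity, amenability\<close>

text \<open>
  No regularity axioms are listed: on a locally compact, second countable Hausdorff space every
  Borel measure that is finite on compact sets is a Radon measure.
\<close>

definition left_haar_measure :: "'a::topological_group_add measure \<Rightarrow> bool" where
  "left_haar_measure m \<longleftrightarrow>
     sets m = sets borel \<and>
     emeasure m UNIV \<noteq> 0 \<and>
     (\<forall>K. compact K \<longrightarrow> emeasure m K < \<infinity>) \<and>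
     (\<forall>g. distr m borel (\<lambda>x. g + x) = m)"

definition unimodular :: "'a::topological_group_add itself \<Rightarrow> bool" where
  "unimodular _ \<longleftrightarrow>
     (\<forall>m :: 'a measure. left_haar_measure m \<longrightarrow> (\<forall>g. distr m borel (\<lambda>x. x + g) = m))"

text \<open>Representatives of the elements of \<open>L\<^sup>\<infinity>(m)\<close>.\<close>

definition ess_bounded :: "'a measure \<Rightarrow> ('a \<Rightarrow> real) set" where
  "ess_bounded m = {f \<in> borel_measurable m. \<exists>B. AE x in m. \<bar>f x\<bar> \<le> B}"

text \<open>
  Linearity and the positivity condition up to null sets imply that a mean takes equal values on
  functions that agree almost everywhere, so it is a functional on \<open>L\<^sup>\<infinity>(m)\<close>.
\<close>

definition left_invariant_mean ::
    "'a::topological_group_add measure \<Rightarrow> (('a \<Rightarrow> real) \<Rightarrow> real) \<Rightarrow> bool" where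
  "left_invariant_mean m \<Lambda> \<longleftrightarrow>
     (\<forall>f\<in>ess_bounded m. \<forall>h\<in>ess_bounded m. \<Lambda> (\<lambda>x. f x + h x) = \<Lambda> f + \<Lambda> h) \<and>
     (\<forall>c. \<forall>f\<in>ess_bounded m. \<Lambda> (\<lambda>x. c * f x) = c * \<Lambda> f) \<and>
     (\<forall>f\<in>ess_bounded m. (AE x in m. 0 \<le> f x) \<longrightarrow> 0 \<le> \<Lambda> f) \<and>
     \<Lambda> (\<lambda>_. 1) = 1 \<and>
     (\<forall>g. \<forall>f\<in>ess_bounded m. \<Lambda> (\<lambda>x. f (g + x)) = \<Lambda> f)"

definition amenable :: "'a::topological_group_add itself \<Rightarrow> bool" where
  "amenable _ \<longleftrightarrow>
     (\<exists>(m :: 'a measure) \<Lambda>. left_haar_measure m \<and> left_invariant_mean m \<Lambda>)"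

section \<open>The Chabauty--Fell space and hulls\<close>

text \<open>Taking \<open>K = {}\<close> shows that the topspace is the set of all closed subsets.\<close>

definition chabauty_fell :: "'a::topological_space set topology" where
  "chabauty_fell = topology_generated_by
     ({{P. closed P \<and> P \<inter> K = {}} | K. compact K} \<union>
      {{P. closed P \<and> P \<inter> U \<noteq> {}} | U. open U})"

definition act :: "'a::group_add \<Rightarrow> 'a set \<Rightarrow> 'a set" where
  "act g P = (\<lambda>x. x - g) ` P"

definition punctured_hull :: "'a::topological_group_add set \<Rightarrow> 'a set set" where
  "punctured_hull P = chabauty_fell closure_of (range (\<lambda>g. act g P)) - {{}}"

definition borel_of :: "'a topology \<Rightarrow> 'a measure" where
  "borel_of T = sigma (topspace T) {U. openin T U}"

definition measured :: "'a::topological_group_add set \<Rightarrow> bool" where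
  "measured P \<longleftrightarrow>
     (\<exists>\<mu>. sets \<mu> = sets (borel_of (subtopology chabauty_fell (punctured_hull P))) \<and>
          prob_space \<mu> \<and>
          (\<forall>g. act g \<in> measurable \<mu> \<mu> \<and> distr \<mu> \<mu> (act g) = \<mu>))"

section \<open>Uniform discreteness and upper density\<close>

definition uniformly_discrete :: "'a::topological_group_add set \<Rightarrow> bool" where
  "uniformly_discrete P \<longleftrightarrow> \<not> 0 islimpt {p - q | p q. p \<in> P \<and> q \<in> P}"

text \<open>
  A uniformly discrete set meets a pre-compact set in a finite set, so \<open>card\<close> is the true
  cardinality where this definition is used.
\<close>

definition upper_density :: "'a measure \<Rightarrow> (nat \<Rightarrow> 'a set) \<Rightarrow> 'a set \<Rightarrow> ereal" where
  "upper_density m D P = limsup (\<lambda>n. ereal (real (card (P \<inter> D n)) / measure m (D n)))"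

text \<open>
  The product \<open>CD\<^sub>n\<close> of a compact and a Borel set need not be Borel, but it is analytic and
  therefore measurable for the completed Haar measure. The set \<open>C\<close> has to be nonempty, since the
  ratio is \<open>0\<close> for \<open>C = {}\<close>.
\<close>

definition strong_folner_sequence ::
    "'a::topological_group_add measure \<Rightarrow> (nat \<Rightarrow> 'a set) \<Rightarrow> bool" where
  "strong_folner_sequence m D \<longleftrightarrow>
     (\<forall>n. D n \<in> sets borel \<and> compact (closure (D n)) \<and> 0 < emeasure m (D n)) \<and>
     (\<forall>C. compact C \<and> C \<noteq> {} \<longrightarrow>
        (\<lambda>n. measure (completion m) {c + d | c d. c \<in> C \<and> d \<in> D n} / measure m (D n))
          \<longlonglongrightarrow> 1)"

end

theory Submission
  imports Defs "HOL-Probability.Projective_Limit"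
begin

text \<open>
  The invariant measure is a limit of the averages of the point masses at \<open>g.P\<close> over
  \<open>g \<in> D\<^sub>n\<close>. To obtain the limit, a closed set \<open>Q\<close> is coded by the 0-1 sequence that
  records which members of a countable base have a closure that meets \<open>Q\<close>. The coded averages have
  a subsequence along which the measures of all cylinder sets converge, and the Kolmogorov extension
  theorem turns the limits into a probability measure on sequences. On the sequences that arise,
  decoding is continuous into the Chabauty--Fell space, so the measure can be transported there; by
  approximation it is concentrated on the closure of the orbit. Invariance only has to be tested on
  the sets \<open>{Q. Q \<inter> K = {}}\<close>, \<open>K\<close> compact, where it follows from the Folner condition for
  \<open>C = {0, g}\<close>. The empty set does not carry all of the mass: for a small compact neighbourhood \<open>C\<close>
  of the identity the translates \<open>C\<^sup>-\<^sup>1p\<close>, \<open>p \<in> P \<inter> D\<^sub>n\<close>, are disjoint, have equal measure by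
  unimodularity, and lie almost inside \<open>D\<^sub>n\<close>.
\<close>

section \<open>Limits of measures on the Cantor space\<close>

text \<open>Compactness of the cube over \<open>'k\<close> replaces the diagonal argument;
  countability of \<open>'k\<close> makes the product first countable, so that compactness yields
  sequential compactness.\<close>

lemma bounded_family_convergent_subseq:
  fixes f :: "nat \<Rightarrow> 'k::countable \<Rightarrow> real"
  assumes "\<And>n k. f n k \<in> {0..1}"
  obtains r where "strict_mono r" "\<And>k. convergent (\<lambda>n. f (r n) k)"
proof -
  have "compactin (product_topology (\<lambda>_. euclidean) UNIV) (PiE UNIV (\<lambda>_::'k. {0..1::real}))"
    by (subst compactin_PiE) auto
  then have "compact (PiE UNIV (\<lambda>_::'k. {0..1::real}))"
    by (simp add: euclidean_product_topology)
  then have "seq_compact (PiE UNIV (\<lambda>_::'k. {0..1::real}))"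
    by (rule compact_imp_seq_compact)
  moreover have "\<forall>n. f n \<in> PiE UNIV (\<lambda>_. {0..1})"
    using assms by auto
  ultimately obtain l r where "strict_mono r" "(f \<circ> r) \<longlonglongrightarrow> l"
    unfolding seq_compact_def by metis
  moreover from this have "(\<lambda>n. f (r n) k) \<longlonglongrightarrow> l k" for k
    using continuous_on_tendsto_compose[OF continuous_on_product_coordinates[of k], of "f \<circ> r" l]
    by (auto simp: o_def)
  ultimately show thesis
    using that by (auto simp: convergent_def)
qed

text \<open>There are countably many cylinder sets, so one subsequence serves all of them, and the
  limits form a consistent family of finite-dimensional distributions. The almost-everywhere clause
  records that finite patterns of \<open>\<omega>\<close> are realised by points \<open>x\<close>;
  it later places the limit on the orbit closure.\<close>

lemma cantor_compactness:
  fixes L :: "nat \<Rightarrow> 'b measure" and X :: "'b \<Rightarrow> nat \<Rightarrow> real"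
  assumes prob: "\<And>n. prob_space (L n)" and sets: "\<And>n. sets (L n) = sets M"
    and meas: "\<And>i. (\<lambda>x. X x i) \<in> borel_measurable M"
    and range: "\<And>x i. X x i = 0 \<or> X x i = 1"
  obtains r \<nu> where "strict_mono r" "prob_space \<nu>"
    "sets \<nu> = sets (Pi\<^sub>M UNIV (\<lambda>_::nat. borel :: real measure))"
    "\<And>J. finite J \<Longrightarrow> AE \<omega> in \<nu>. \<exists>x\<in>space M. \<forall>i\<in>J. \<omega> i = X x i"
    "\<And>i. (\<lambda>n. measure (L (r n)) {x \<in> space M. X x i = 0}) \<longlonglongrightarrow> measure \<nu> {\<omega>. \<omega> i = 0}"
proof -
  have space: "space (L n) = space M" for n
    using sets sets_eq_imp_space_eq by blast
  note [measurable] = meas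
  \<comment> \<open>A cylinder is indexed by the list of coordinates equal to 1 and the list of
    those equal to 0; pairs of lists form a countable type, as the selection lemma requires.\<close>
  define f where "f n k = measure (L n) {x \<in> space M. (\<forall>i\<in>set (fst k). X x i = 1) \<and> (\<forall>i\<in>set (snd k). X x i = 0)}"
    for n and k :: "nat list \<times> nat list"
  have "f n k \<in> {0..1}" for n k
    using prob_space.prob_le_1[OF prob] by (auto simp: f_def)
  then obtain r where r: "strict_mono r" and conv: "\<And>k. convergent (\<lambda>n. f (r n) k)"
    using bounded_family_convergent_subseq by blast
  define F where "F J = (PiE J (\<lambda>_. {0,1}) :: (nat \<Rightarrow> real) set)" for J
  have finF: "finite (F J)" if "finite J" for J
    unfolding F_def using that by (auto intro!: finite_PiE)
  have XF: "restrict (X x) J \<in> F J" for x J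
    using range by (auto simp: F_def)
  define S where "S J B = {x \<in> space M. restrict (X x) J \<in> B}" for J B
  have S1: "S J {h} = {x \<in> space M. \<forall>i\<in>J. X x i = h i}" if "h \<in> F J" for J h
    using that unfolding S_def F_def by (auto simp: fun_eq_iff PiE_def extensional_def split: if_splits)
  have S1m: "S J {h} \<in> sets M" if "h \<in> F J" "finite J" for J h
    unfolding S1[OF that(1)] using that by measurable
  have SU: "S J B = (\<Union>h\<in>B \<inter> F J. S J {h})" for J B
    using XF by (auto simp: S_def)
  have mS: "measure (L n) (S J B) = (\<Sum>h\<in>B \<inter> F J. measure (L n) (S J {h}))" if "finite J" for n J B
  proof -
    interpret prob_space "L n" by (rule prob)
    show ?thesis
      unfolding SU[of J B]
    proof (rule finite_measure_finite_Union)
      show "disjoint_family_on (\<lambda>h. S J {h}) (B \<inter> F J)"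
        by (auto simp: disjoint_family_on_def S_def)
    qed (use that finF sets S1m in auto)
  qed
  have c1: "convergent (\<lambda>n. measure (L (r n)) (S J {h}))" if "finite J" "h \<in> F J" for J h
  proof -
    obtain xs where xs: "set xs = {i\<in>J. h i = 1}" using \<open>finite J\<close> finite_list[of "{i\<in>J. h i = 1}"] by auto
    obtain ys where ys: "set ys = {i\<in>J. h i = 0}" using \<open>finite J\<close> finite_list[of "{i\<in>J. h i = 0}"] by auto
    have "h i = 0 \<or> h i = 1" if "i \<in> J" for i using \<open>h \<in> F J\<close> that by (auto simp: F_def)
    then have "S J {h} = {x \<in> space M. (\<forall>i\<in>set xs. X x i = 1) \<and> (\<forall>i\<in>set ys. X x i = 0)}"
      unfolding S1[OF that(2)] xs ys by auto (metis range)+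
    then show ?thesis using conv[of "(xs, ys)"] by (simp add: f_def)
  qed
  define c where "c J B = lim (\<lambda>n. measure (L (r n)) (S J B))" for J B
  have c: "(\<lambda>n. measure (L (r n)) (S J B)) \<longlonglongrightarrow> c J B" if "finite J" for J B
  proof -
    have "convergent (\<lambda>n. \<Sum>h\<in>B \<inter> F J. measure (L (r n)) (S J {h}))"
      using c1[OF that] by (intro convergent_sum) blast
    then have "convergent (\<lambda>n. measure (L (r n)) (S J B))"
      by (subst mS[OF that])
    then show ?thesis
      unfolding c_def by (simp add: convergent_LIMSEQ_iff)
  qed
  have c_nonneg: "0 \<le> c J B" if "finite J" for J B
    using c[OF that] by (rule LIMSEQ_le_const) auto
  have c_sum: "c J B = (\<Sum>h\<in>B \<inter> F J. c J {h})" if "finite J" for J B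
  proof (rule LIMSEQ_unique[OF c[OF that]])
    show "(\<lambda>n. measure (L (r n)) (S J B)) \<longlonglongrightarrow> (\<Sum>h\<in>B \<inter> F J. c J {h})"
      by (subst mS[OF that]) (intro tendsto_sum c that)
  qed
  have c_top: "c J B = 1" if "finite J" "\<And>x. x \<in> space M \<Longrightarrow> restrict (X x) J \<in> B" for J B
  proof (rule LIMSEQ_unique[OF c[OF that(1)]])
    have "S J B = space M" using that(2) by (auto simp: S_def)
    then have "measure (L (r n)) (S J B) = 1" for n
      using prob_space.prob_space[OF prob] space by metis
    then show "(\<lambda>n. measure (L (r n)) (S J B)) \<longlonglongrightarrow> 1" by simp
  qed
  \<comment> \<open>The limit weights sit on finitely many patterns; pushing forward along the
    inclusion of \<open>F J\<close> places them on the product space with its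
    \<sigma>-algebra.\<close>
  define P where "P J = distr (point_measure (F J) (\<lambda>h. ennreal (c J {h}))) (Pi\<^sub>M J (\<lambda>_. borel)) (\<lambda>h. h)" for J
  have emP: "emeasure (P J) B = ennreal (c J B)" if "finite J" "B \<in> sets (Pi\<^sub>M J (\<lambda>_. borel))" for J B
  proof -
    have "emeasure (P J) B = emeasure (point_measure (F J) (\<lambda>h. ennreal (c J {h}))) (B \<inter> F J)"
      unfolding P_def using that
      by (subst emeasure_distr) (auto simp: space_point_measure space_PiM F_def measurable_def sets_point_measure)
    also have "\<dots> = ennreal (c J B)"
      using that by (subst emeasure_point_measure_finite)
        (simp_all add: finF c_nonneg sum_ennreal, subst c_sum, simp_all)
    finally show ?thesis .
  qed
  have P_sets: "sets (P J) = sets (Pi\<^sub>M J (\<lambda>_. borel))" for J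
    by (simp add: P_def)
  interpret polish_projective UNIV P
  proof (unfold polish_projective_def, rule projective_family.intro)
    fix J H :: "nat set" assume JH: "J \<subseteq> H" "finite H"
    then have J: "finite J" using finite_subset by blast
    show "P J = distr (P H) (Pi\<^sub>M J (\<lambda>_. borel)) (\<lambda>f. restrict f J)"
    proof (rule measure_eqI)
      fix B assume "B \<in> sets (P J)"
      then have B: "B \<in> sets (Pi\<^sub>M J (\<lambda>_. borel))" by (simp add: P_sets)
      have m: "(\<lambda>f. restrict f J) \<in> measurable (P H) (Pi\<^sub>M J (\<lambda>_. borel))"
        using measurable_restrict_subset[OF JH(1)] by (simp add: measurable_def P_sets sets_eq_imp_space_eq[OF P_sets])
      have B': "(\<lambda>f. restrict f J) -` B \<inter> space (P H) \<in> sets (Pi\<^sub>M H (\<lambda>_. borel))"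
        using measurable_sets[OF m B] by (simp add: P_sets)
      \<comment> \<open>Consistency holds before the limit: restricting to \<open>H\<close> and then
        to \<open>J\<close> is restricting to \<open>J\<close>, so both sides come from the same
        subset of \<open>space M\<close>.\<close>
      have "S H ((\<lambda>f. restrict f J) -` B \<inter> space (P H)) = S J B"
        using JH by (auto simp: S_def sets_eq_imp_space_eq[OF P_sets] space_PiM restrict_restrict Int_absorb1)
      then have "c H ((\<lambda>f. restrict f J) -` B \<inter> space (P H)) = c J B"
        by (simp add: c_def)
      then show "emeasure (P J) B = emeasure (distr (P H) (Pi\<^sub>M J (\<lambda>_. borel)) (\<lambda>f. restrict f J)) B"
        by (simp add: emeasure_distr[OF m B] emP[OF J B] emP[OF \<open>finite H\<close> B'])
    qed (simp add: P_sets)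
  next
    fix J :: "nat set" assume J: "finite J"
    show "prob_space (P J)"
    proof (rule prob_spaceI)
      show "emeasure (P J) (space (P J)) = 1"
        using emP[OF J sets.top] c_top[OF J, of "space (Pi\<^sub>M J (\<lambda>_. borel))"] 
        by (simp add: sets_eq_imp_space_eq[OF P_sets] space_PiM)
    qed
  qed
  \<comment> \<open>From here on \<open>lim\<close> is the projective limit measure, no longer the
    limit of a real sequence as in the definition of \<open>c\<close>.\<close>
  have lim: "emeasure lim {\<omega>. restrict \<omega> J \<in> B} = ennreal (c J B)" if "finite J" "B \<in> sets (Pi\<^sub>M J (\<lambda>_. borel))" for J B
  proof -
    have "{\<omega>. restrict \<omega> J \<in> B} = emb UNIV J B"
      by (auto simp: prod_emb_def)
    then show ?thesis
      using emeasure_lim_emb[of J B] that emP[OF that] by simp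
  qed
  have P_prob: "prob_space lim" by (rule P.prob_space_axioms)
  have sl: "sets lim = sets (Pi\<^sub>M UNIV (\<lambda>_. borel))" by simp
  show thesis
  proof (rule that[OF r P_prob sl])
    fix J :: "nat set" assume J: "finite J"
    \<comment> \<open>The patterns that occur have full measure for every \<open>n\<close>; being
      finite in number, they form a measurable set, and it keeps full measure in the limit.\<close>
    define B where "B = (\<lambda>x. restrict (X x) J) ` space M"
    have "B \<subseteq> F J" using XF by (auto simp: B_def)
    then have "finite B" using finF[OF J] finite_subset by blast
    moreover have "{h} \<in> sets (Pi\<^sub>M J (\<lambda>_. borel))" if "h \<in> B" for h
    proof -
      have "{h} = PiE J (\<lambda>i. {h i})"
        using that by (subst PiE_singleton) (auto simp: B_def)
      then show ?thesis using J by (auto intro!: sets_PiM_I_finite)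
    qed
    ultimately have "(\<Union>h\<in>B. {h}) \<in> sets (Pi\<^sub>M J (\<lambda>_. borel))"
      by (intro sets.finite_UN) auto
    then have B: "B \<in> sets (Pi\<^sub>M J (\<lambda>_. borel))" by simp
    have "c J B = 1" by (rule c_top[OF J]) (auto simp: B_def)
    then have "emeasure lim {\<omega>. restrict \<omega> J \<in> B} = 1" using lim[OF J B] by simp
    moreover have "{\<omega>. restrict \<omega> J \<in> B} \<in> sets lim"
      using measurable_sets[OF measurable_restrict_subset[of J UNIV "\<lambda>_. borel"] B]
      by (simp add: vimage_def space_PiM)
    ultimately have "AE \<omega> in lim. \<omega> \<in> {\<omega>. restrict \<omega> J \<in> B}"
      by (intro P.AE_prob_1) (simp add: measure_def)
    then show "AE \<omega> in lim. \<exists>x\<in>space M. \<forall>i\<in>J. \<omega> i = X x i"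
    proof eventually_elim
      fix \<omega> assume "\<omega> \<in> {\<omega>. restrict \<omega> J \<in> B}"
      then obtain x where "x \<in> space M" "restrict \<omega> J = restrict (X x) J" by (auto simp: B_def)
      then show "\<exists>x\<in>space M. \<forall>i\<in>J. \<omega> i = X x i"
        by (metis restrict_apply')
    qed
  next
    fix i :: nat
    have B: "PiE {i} (\<lambda>_. {0}) \<in> sets (Pi\<^sub>M {i} (\<lambda>_. borel :: real measure))"
      by (rule sets_PiM_I_finite) auto
    have "{\<omega>. \<omega> i = 0} = {\<omega>. restrict \<omega> {i} \<in> PiE {i} (\<lambda>_. {0::real})}"
      by (simp only: restrict_PiE_iff) simp
    then have "measure lim {\<omega>. \<omega> i = 0} = c {i} (PiE {i} (\<lambda>_. {0}))"
      using lim[OF _ B] c_nonneg by (simp add: measure_def)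
    moreover have "S {i} (PiE {i} (\<lambda>_. {0})) = {x \<in> space M. X x i = 0}"
      by (simp only: S_def restrict_PiE_iff) simp
    ultimately show "(\<lambda>n. measure (L (r n)) {x \<in> space M. X x i = 0}) \<longlonglongrightarrow> measure lim {\<omega>. \<omega> i = 0}"
      using c[of "{i}" "PiE {i} (\<lambda>_. {0})"] by simp
  qed
qed

section \<open>The Chabauty--Fell Borel structure\<close>

lemma sets_borel_of: "sets (borel_of T) = sigma_sets (topspace T) {U. openin T U}"
  unfolding borel_of_def by (rule sets_measure_of) (blast dest: openin_subset)

lemma space_borel_of [simp]: "space (borel_of T) = topspace T"
  unfolding borel_of_def by (rule space_measure_of) (blast dest: openin_subset)

lemma openin_borel_of: "openin T U \<Longrightarrow> U \<in> sets (borel_of T)"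
  by (simp add: sets_borel_of)

lemma closedin_borel_of: "closedin T C \<Longrightarrow> C \<in> sets (borel_of T)"
  using sets.compl_sets[OF openin_borel_of, of T "topspace T - C"]
  by (simp only: closedin_def space_borel_of double_diff subset_refl)

lemma continuous_map_measurable_borel_of:
  assumes "continuous_map S T f"
  shows "f \<in> measurable (borel_of S) (borel_of T)"
  unfolding borel_of_def[of T]
proof (rule measurable_measure_of)
  show "f \<in> space (borel_of S) \<rightarrow> topspace T"
    using assms by (auto simp: continuous_map_def)
  fix U assume "U \<in> {U. openin T U}"
  then have "openin S {x \<in> topspace S. f x \<in> U}"
    using assms by (auto simp: continuous_map_def)
  moreover have "f -` U \<inter> space (borel_of S) = {x \<in> topspace S. f x \<in> U}"
    by auto
  ultimately show "f -` U \<inter> space (borel_of S) \<in> sets (borel_of S)"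
    by (simp add: openin_borel_of)
qed (blast dest: openin_subset)

lemma sets_borel_of_subtopology:
  assumes "H \<in> sets (borel_of T)"
  shows "sets (borel_of (subtopology T H)) = sets (restrict_space (borel_of T) H)"
proof -
  have H: "H \<subseteq> topspace T"
    using sets.sets_into_space[OF assms] by simp
  have "{U. openin (subtopology T H) U} = (\<inter>) H ` {U. openin T U}"
    by (simp only: set_eq_iff mem_Collect_eq openin_subtopology image_iff Bex_def Int_commute[of _ H] simp_thms)
  moreover have "topspace (subtopology T H) = H"
    using H by (simp add: Int_absorb1)
  ultimately have "sets (borel_of (subtopology T H)) = sigma_sets H ((\<inter>) H ` {U. openin T U})"
    by (simp only: sets_borel_of)
  also have "\<dots> = (\<inter>) H ` sigma_sets (topspace T) {U. openin T U}"
    using sigma_sets_Int[of H "topspace T" "{U. openin T U}"] H assms by (simp only: sets_borel_of)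
  finally show ?thesis
    by (simp only: sets_restrict_space sets_borel_of)
qed

abbreviation miss :: "'a::topological_space set \<Rightarrow> 'a set set" where
  "miss K \<equiv> {P. closed P \<and> P \<inter> K = {}}"

abbreviation hit :: "'a::topological_space set \<Rightarrow> 'a set set" where
  "hit V \<equiv> {P. closed P \<and> P \<inter> V \<noteq> {}}"

lemma topspace_chabauty_fell [simp]: "topspace chabauty_fell = {P. closed P}"
  unfolding chabauty_fell_def topology_generated_by_topspace
proof (intro equalityI subsetI)
  fix P :: "'a set" assume "P \<in> {P. closed P}"
  then have "P \<in> miss {}" by simp
  moreover have "miss {} \<in> {miss K |K. compact (K :: 'a set)}"
    by (rule CollectI, rule exI[of _ "{}"]) simp
  ultimately show "P \<in> \<Union> ({miss K |K. compact K} \<union> {hit V |V. open V})"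
    by (intro UnionI UnI1)
qed blast

lemma openin_miss: "compact K \<Longrightarrow> openin chabauty_fell (miss K)"
  unfolding chabauty_fell_def by (rule topology_generated_by_Basis) blast

lemma openin_hit: "open V \<Longrightarrow> openin chabauty_fell (hit V)"
  unfolding chabauty_fell_def by (rule topology_generated_by_Basis) blast

lemma continuous_map_into_chabauty_fell:
  fixes f :: "'b \<Rightarrow> 'a::topological_space set"
  assumes "\<And>x. x \<in> topspace S \<Longrightarrow> closed (f x)"
    and "\<And>K. compact K \<Longrightarrow> openin S {x \<in> topspace S. f x \<inter> K = {}}"
    and "\<And>V. open V \<Longrightarrow> openin S {x \<in> topspace S. f x \<inter> V \<noteq> {}}"
  shows "continuous_map S chabauty_fell f"
  unfolding chabauty_fell_def
proof (rule continuous_on_generated_topo)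
  fix W :: "'a set set" assume "W \<in> {miss K |K. compact K} \<union> {hit V |V. open V}"
  then consider K where "compact K" "W = miss K" | V where "open V" "W = hit V" by blast
  then show "openin S (f -` W \<inter> topspace S)"
  proof cases
    case 1
    then have "f -` W \<inter> topspace S = {x \<in> topspace S. f x \<inter> K = {}}" using assms(1) by auto
    then show ?thesis using assms(2) 1 by simp
  next
    case 2
    then have "f -` W \<inter> topspace S = {x \<in> topspace S. f x \<inter> V \<noteq> {}}" using assms(1) by auto
    then show ?thesis using assms(3) 2 by simp
  qed
next
  show "f ` topspace S \<subseteq> \<Union> ({miss K |K. compact K} \<union> {hit V |V. open V})"
    using assms(1) topspace_chabauty_fell[where 'a = 'a]
    unfolding chabauty_fell_def topology_generated_by_topspace by (simp only:) auto
qed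

section \<open>Coding closed sets by sequences\<close>

text \<open>Interpolation for compact sets, and not only for points, lets a single coordinate
  witness a condition on a whole compact set, where a mere base would need a finite cover.\<close>

locale compact_base =
  fixes U :: "nat \<Rightarrow> 'a::t2_space set"
  assumes open_U: "open (U i)"
    and compact_closure_U: "compact (closure (U i))"
    and interpolate: "compact K \<Longrightarrow> open W \<Longrightarrow> K \<subseteq> W \<Longrightarrow> \<exists>i. K \<subseteq> U i \<and> closure (U i) \<subseteq> W"
begin

text \<open>Testing against the compact closure makes \<open>code Q i = 0\<close> a subbasic open
  condition on closed sets \<open>Q\<close>.\<close>

definition code :: "'a set \<Rightarrow> nat \<Rightarrow> real" where
  "code Q i = (if Q \<inter> closure (U i) = {} then 0 else 1)"

text \<open>Removing the open sets \<open>U i\<close>, and not their closures, gives a closed set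
  for every \<open>w\<close>; interpolation ensures that nothing is lost on codes.\<close>

definition decode :: "(nat \<Rightarrow> real) \<Rightarrow> 'a set" where
  "decode w = - \<Union> {U i |i. w i = 0}"

text \<open>
  The 0-1 sequences with the monotonicity under finite covers that codes of closed sets have; it is
  what makes decoding continuous.
\<close>

definition coherent :: "(nat \<Rightarrow> real) set" where
  "coherent = {w. (\<forall>i. w i = 0 \<or> w i = 1) \<and>
     (\<forall>J. finite J \<longrightarrow> (\<forall>i. closure (U i) \<subseteq> \<Union> (U ` J) \<longrightarrow> (\<forall>j\<in>J. w j = 0) \<longrightarrow> w i = 0))}"

lemma code_01: "code Q i = 0 \<or> code Q i = 1"
  by (simp add: code_def)

lemma coherent_01:
  assumes "w \<in> coherent"
  shows "w i = 0 \<or> w i = 1"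
proof -
  have "\<forall>i. w i = 0 \<or> w i = 1"
    using assms unfolding coherent_def by (elim CollectE conjE)
  then show ?thesis ..
qed

lemma coherent_zero:
  assumes "w \<in> coherent" "finite J" "closure (U i) \<subseteq> \<Union> (U ` J)" "\<forall>j\<in>J. w j = 0"
  shows "w i = 0"
proof -
  have "\<forall>J. finite J \<longrightarrow> (\<forall>i. closure (U i) \<subseteq> \<Union> (U ` J) \<longrightarrow> (\<forall>j\<in>J. w j = 0) \<longrightarrow> w i = 0)"
    using assms(1) unfolding coherent_def by (elim CollectE conjE)
  then show ?thesis using assms(2-4) by iprover
qed

lemma code_coherent: "code Q \<in> coherent"
proof -
  have "code Q i = 0"
    if sub: "closure (U i) \<subseteq> \<Union> (U ` J)" and zero: "\<forall>j\<in>J. code Q j = 0" for i J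
  proof -
    have "Q \<inter> U j = {}" if "j \<in> J" for j
    proof -
      have "Q \<inter> closure (U j) = {}"
        using zero that unfolding code_def by (metis zero_neq_one)
      then show ?thesis using closure_subset[of "U j"] by auto
    qed
    then have "Q \<inter> \<Union> (U ` J) = {}" by auto
    then have "Q \<inter> closure (U i) = {}" using sub by auto
    then show ?thesis by (simp add: code_def)
  qed
  then show ?thesis
    unfolding coherent_def by (simp add: code_01)
qed

lemma closed_decode: "closed (decode w)"
  unfolding decode_def using open_U by (auto intro!: open_Union)

lemma decode_code:
  assumes "closed Q"
  shows "decode (code Q) = Q"
proof -
  have "\<exists>i. x \<in> U i \<and> code Q i = 0" if "x \<notin> Q" for x
    using interpolate[of "{x}" "- Q"] that assms by (auto simp: code_def)
  moreover have "code Q i \<noteq> 0" if "x \<in> Q" "x \<in> U i" for x i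
    using that closure_subset[of "U i"] by (auto simp: code_def)
  ultimately show ?thesis by (fastforce simp: decode_def)
qed

text \<open>The sets \<open>U i\<close> with \<open>w i = 0\<close> cover \<open>K\<close>; a finite
  subcover, interpolation between \<open>K\<close> and its union, and coherence compress the cover
  to one index.\<close>

lemma decode_miss:
  assumes "w \<in> coherent" "compact K"
  shows "decode w \<inter> K = {} \<longleftrightarrow> (\<exists>i. K \<subseteq> U i \<and> w i = 0)"
proof
  assume "decode w \<inter> K = {}"
  then have "K \<subseteq> (\<Union>i\<in>{i. w i = 0}. U i)" by (auto simp: decode_def)
  then obtain J where J: "J \<subseteq> {i. w i = 0}" "finite J" "K \<subseteq> (\<Union>i\<in>J. U i)"
    using compactE_image[OF assms(2)] open_U by metis
  then obtain i where "K \<subseteq> U i" "closure (U i) \<subseteq> \<Union> (U ` J)"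
    using interpolate[OF assms(2) open_UN[of J U]] open_U by blast
  moreover have "w i = 0"
    using coherent_zero[OF assms(1) J(2) calculation(2)] J(1) by blast
  ultimately show "\<exists>i. K \<subseteq> U i \<and> w i = 0" by blast
qed (auto simp: decode_def)

text \<open>If the decoded set missed \<open>closure (U i)\<close>, then \<open>decode_miss\<close>
  for this compact set would give a \<open>U j\<close> around it with \<open>w j = 0\<close>, and
  coherence would force \<open>w i = 0\<close>.\<close>

lemma decode_hit:
  assumes "w \<in> coherent" "open V"
  shows "decode w \<inter> V \<noteq> {} \<longleftrightarrow> (\<exists>i. closure (U i) \<subseteq> V \<and> w i = 1)"
proof
  assume "decode w \<inter> V \<noteq> {}"
  then obtain x where x: "x \<in> decode w" "x \<in> V" by auto
  then obtain i where i: "x \<in> U i" "closure (U i) \<subseteq> V"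
    using interpolate[of "{x}" V] assms(2) by auto
  then have "w i \<noteq> 0" using x by (auto simp: decode_def)
  then show "\<exists>i. closure (U i) \<subseteq> V \<and> w i = 1"
    using i coherent_01[OF assms(1)] by blast
next
  assume "\<exists>i. closure (U i) \<subseteq> V \<and> w i = 1"
  then obtain i where i: "closure (U i) \<subseteq> V" "w i = 1" by blast
  have "decode w \<inter> closure (U i) \<noteq> {}"
  proof
    assume "decode w \<inter> closure (U i) = {}"
    then obtain j where "closure (U i) \<subseteq> U j" "w j = 0"
      using decode_miss[OF assms(1) compact_closure_U] by blast
    then have "w i = 0"
      using coherent_zero[OF assms(1), of "{j}" i] by simp
    then show False using i by simp
  qed
  then show "decode w \<inter> V \<noteq> {}" using i by blast
qed

lemma continuous_map_decode: "continuous_map (top_of_set coherent) chabauty_fell decode"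
proof -
  \<comment> \<open>On 0-1 sequences the equations are equivalent to strict inequalities, which are
    open conditions in the product topology.\<close>
  have half: "w i = 0 \<longleftrightarrow> w i < 1/2" "w i = 1 \<longleftrightarrow> w i > 1/2" if "w \<in> coherent" for w i
    using coherent_01[OF that, of i] by auto
  have op: "open {w. w i < (1/2::real)}" "open {w. w i > (1/2::real)}" for i :: nat
    by (intro open_Collect_less continuous_intros continuous_on_product_coordinates)+
  show ?thesis
  proof (rule continuous_map_into_chabauty_fell)
  fix K :: "'a set" assume K: "compact K"
  have "decode w \<inter> K = {} \<longleftrightarrow> (\<exists>i. K \<subseteq> U i \<and> w i < 1/2)" if "w \<in> coherent" for w
    by (simp only: decode_miss[OF that K] half(1)[OF that])
  then have "{w \<in> coherent. decode w \<inter> K = {}} = coherent \<inter> (\<Union>i\<in>{i. K \<subseteq> U i}. {w. w i < 1/2})"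
    by auto
  then have "openin (top_of_set coherent) {w \<in> coherent. decode w \<inter> K = {}}"
    by (simp only:) (intro openin_open_Int open_UN ballI op)
  then show "openin (top_of_set coherent) {w \<in> topspace (top_of_set coherent). decode w \<inter> K = {}}"
    by simp
  next
  fix V :: "'a set" assume V: "open V"
  have "decode w \<inter> V \<noteq> {} \<longleftrightarrow> (\<exists>i. closure (U i) \<subseteq> V \<and> w i > 1/2)" if "w \<in> coherent" for w
    by (simp only: decode_hit[OF that V] half(2)[OF that])
  then have "{w \<in> coherent. decode w \<inter> V \<noteq> {}} = coherent \<inter> (\<Union>i\<in>{i. closure (U i) \<subseteq> V}. {w. w i > 1/2})"
    by auto
  then have "openin (top_of_set coherent) {w \<in> coherent. decode w \<inter> V \<noteq> {}}"
    by (simp only:) (intro openin_open_Int open_UN ballI op)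
  then show "openin (top_of_set coherent) {w \<in> topspace (top_of_set coherent). decode w \<inter> V \<noteq> {}}"
    by simp
  qed (simp add: closed_decode)
qed

text \<open>Quantifying over lists makes the family of conditions visibly countable, as the
  measurability of \<open>coherent\<close> requires.\<close>

lemma coherent_list:
  "coherent = {w. (\<forall>i. w i = 0 \<or> w i = 1) \<and>
     (\<forall>xs i. closure (U i) \<subseteq> \<Union> (U ` set xs) \<longrightarrow> (\<forall>j\<in>set xs. w j = 0) \<longrightarrow> w i = 0)}"
proof -
  have "(\<forall>J. finite J \<longrightarrow> A J) \<longleftrightarrow> (\<forall>xs. A (set xs))" for A :: "nat set \<Rightarrow> bool"
    by (metis List.finite_set finite_list)
  then show ?thesis unfolding coherent_def by (simp only:)
qed

lemma sets_coherent: "coherent \<in> sets (Pi\<^sub>M UNIV (\<lambda>_. borel))"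
proof -
  define Z where "Z i = {w :: nat \<Rightarrow> real. w i = 0}" for i
  have level: "{w. w i = c} \<in> sets (Pi\<^sub>M UNIV (\<lambda>_. borel))" for i :: nat and c :: real
    using measurable_sets[OF measurable_component_singleton[of i UNIV "\<lambda>_. borel"], of "{c}"]
    by (simp add: vimage_def space_PiM)
  have compl: "- A \<in> sets (Pi\<^sub>M UNIV (\<lambda>_. borel))" if "A \<in> sets (Pi\<^sub>M UNIV (\<lambda>_. borel))" for A :: "(nat \<Rightarrow> real) set"
    using sets.compl_sets[OF that] by (simp add: space_PiM Compl_eq_Diff_UNIV)
  have "coherent = (\<Inter>i. Z i \<union> {w. w i = 1}) \<inter>
     (\<Inter>(xs, i)\<in>{(xs, i). closure (U i) \<subseteq> \<Union> (U ` set xs)}. (\<Union>j\<in>set xs. - Z j) \<union> Z i)"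
    unfolding coherent_list Z_def by auto
  moreover have "(\<Inter>(xs, i)\<in>I. (\<Union>j\<in>set xs. - Z j) \<union> Z i) \<in> sets (Pi\<^sub>M UNIV (\<lambda>_. borel))"
    for I :: "(nat list \<times> nat) set"
  \<comment> \<open>The rule for countable intersections asks for a nonempty index set; the empty
    intersection is the whole space.\<close>
  proof (cases "I = {}")
    case False
    then show ?thesis
      unfolding case_prod_beta Z_def
      by (intro sets.countable_INT' sets.Un sets.finite_UN image_subsetI compl level) auto
  next
    case True
    then show ?thesis
      using sets.top[of "Pi\<^sub>M (UNIV :: nat set) (\<lambda>_. borel :: real measure)"] by (simp add: space_PiM)
  qed
  moreover have "(\<Inter>i. Z i \<union> {w. w i = 1}) \<in> sets (Pi\<^sub>M UNIV (\<lambda>_. borel))"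
    unfolding Z_def by (intro sets.countable_INT' sets.Un image_subsetI level) auto
  ultimately show ?thesis by simp
qed

text \<open>Over a countable index set the product \<sigma>-algebra contains all open sets of the
  product topology, so continuity on \<open>coherent\<close> gives measurability.\<close>

lemma measurable_decode:
  "decode \<in> measurable (restrict_space (Pi\<^sub>M UNIV (\<lambda>_. borel)) coherent) (borel_of chabauty_fell)"
  unfolding borel_of_def
proof (rule measurable_measure_of)
  fix W :: "'a set set" assume "W \<in> {W. openin chabauty_fell W}"
  then have "openin (top_of_set coherent) {w \<in> coherent. decode w \<in> W}"
    using continuous_map_decode by (auto simp: continuous_map_def)
  then obtain T where "open T" "{w \<in> coherent. decode w \<in> W} = coherent \<inter> T"
    by (auto simp: openin_open)
  moreover have "T \<in> sets (Pi\<^sub>M UNIV (\<lambda>_. borel))"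
    using \<open>open T\<close> by (simp add: sets_PiM_equal_borel)
  moreover have "decode -` W \<inter> space (restrict_space (Pi\<^sub>M UNIV (\<lambda>_. borel)) coherent) = {w \<in> coherent. decode w \<in> W}"
    by (auto simp: space_restrict_space space_PiM)
  ultimately show "decode -` W \<inter> space (restrict_space (Pi\<^sub>M UNIV (\<lambda>_. borel)) coherent)
      \<in> sets (restrict_space (Pi\<^sub>M UNIV (\<lambda>_. borel)) coherent)"
    by (auto simp: sets_restrict_space)
qed (use openin_subset in blast, simp add: closed_decode)

text \<open>On closed sets \<open>decode\<close> inverts \<open>code\<close>, so an open
  \<open>W\<close> is the preimage under \<open>code\<close> of a measurable set of sequences, and
  each coordinate of \<open>code\<close> is decided by a miss set. Since miss sets are stable under
  intersection, finite measures can be compared on them.\<close>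

lemma sets_borel_of_chabauty_fell:
  "sets (borel_of (chabauty_fell :: 'a set topology)) = sigma_sets {P. closed P} {miss K |K. compact K}"
proof (intro equalityI)
  let ?M = "sigma {P. closed P} {miss K |K. compact (K :: 'a set)}"
  have sets_M: "sets ?M = sigma_sets {P. closed P} {miss K |K. compact (K :: 'a set)}"
    by (rule sets_measure_of) auto
  have space_M: "space ?M = {P. closed P}"
    by (rule space_measure_of) auto
  have code: "code \<in> measurable ?M (Pi\<^sub>M UNIV (\<lambda>_. borel))"
  proof (rule measurable_PiM_single')
    fix i
    have "{P \<in> space ?M. P \<inter> closure (U i) = {}} \<in> sets ?M"
      unfolding space_M sets_M using compact_closure_U by (auto intro!: sigma_sets.Basic)
    then show "(\<lambda>P. code P i) \<in> borel_measurable ?M"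
      unfolding code_def by (intro measurable_If) auto
  qed (auto simp: space_M)
  have "W \<in> sets ?M" if "openin chabauty_fell W" for W
  proof -
    have "decode -` W \<inter> coherent \<in> sets (restrict_space (Pi\<^sub>M UNIV (\<lambda>_. borel)) coherent)"
      using measurable_sets[OF measurable_decode openin_borel_of[OF that]]
      by (simp add: space_restrict_space space_PiM)
    then have "decode -` W \<inter> coherent \<in> sets (Pi\<^sub>M UNIV (\<lambda>_. borel))"
      using sets_coherent by (simp add: sets_restrict_space_iff)
    from measurable_sets[OF code this]
    have "code -` (decode -` W \<inter> coherent) \<inter> {P. closed P} \<in> sets ?M"
      by (simp add: space_M)
    moreover have "code -` (decode -` W \<inter> coherent) \<inter> {P. closed P} = W"
      using openin_subset[OF that] by (auto simp: code_coherent decode_code)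
    ultimately show ?thesis by simp
  qed
  then have "{W. openin chabauty_fell W} \<subseteq> sets ?M"
    by blast
  from sets.sigma_sets_subset[OF this]
  show "sets (borel_of chabauty_fell) \<subseteq> sigma_sets {P. closed P} {miss K |K. compact (K :: 'a set)}"
    by (simp only: sets_borel_of topspace_chabauty_fell space_M sets_M)
  have "{miss K |K. compact (K :: 'a set)} \<subseteq> sets (borel_of chabauty_fell)"
    using openin_borel_of openin_miss by blast
  from sets.sigma_sets_subset[OF this]
  show "sigma_sets {P. closed P} {miss K |K. compact (K :: 'a set)} \<subseteq> sets (borel_of chabauty_fell)"
    by (simp only: space_borel_of topspace_chabauty_fell)
qed

end

section \<open>Existence of a base for the coding\<close>

lemma closure_finite_Union:
  assumes "finite F"
  shows "closure (\<Union>F) = \<Union> (closure ` F)"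
  using assms by induction (simp_all add: closure_Un)

text \<open>The finite unions of relatively compact members of a countable base form a countable
  family; compactness of \<open>K\<close> selects one of them inside \<open>W\<close>.\<close>

lemma compact_base_exists:
  assumes "locally_compact_space (euclidean :: 'a::{second_countable_topology,t2_space} topology)"
  shows "\<exists>U :: nat \<Rightarrow> 'a set. compact_base U"
proof -
  have nb: "\<exists>V. open V \<and> compact (closure V) \<and> x \<in> V \<and> closure V \<subseteq> W" if "open W" "x \<in> W" for x :: 'a and W
  proof -
    have "Hausdorff_space (euclidean :: 'a topology)"
      unfolding Hausdorff_space_def disjnt_def open_openin[symmetric] using hausdorff by blast
    then have "neighbourhood_base_of (\<lambda>C. compactin euclidean C \<and> closedin euclidean C) (euclidean :: 'a topology)"
      using assms by (simp only: locally_compact_space_neighbourhood_base_closedin[OF disjI1])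
    moreover have "openin euclidean W \<and> x \<in> W" using that by simp
    ultimately have "\<exists>V C. openin euclidean V \<and> (compactin euclidean C \<and> closedin euclidean C) \<and> x \<in> V \<and> V \<subseteq> C \<and> C \<subseteq> W"
      unfolding neighbourhood_base_of by (elim allE impE)
    then obtain V C where "open V" "compact C" "closed C" "x \<in> V" "V \<subseteq> C" "C \<subseteq> W"
      by auto
    then show ?thesis
      using closure_minimal[of V C] compact_Int_closed[of C "closure V"] by (auto simp: Int_absorb1)
  qed
  obtain \<B> :: "'a set set" where \<B>: "countable \<B>" "topological_basis \<B>"
    using ex_countable_basis by blast
  define \<C> where "\<C> = (\<Union>) ` {F. finite F \<and> F \<subseteq> {B\<in>\<B>. compact (closure B)}}"
  have "countable \<C>"
    unfolding \<C>_def using \<B>(1) by (intro countable_image countable_Collect_finite_subset) auto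
  \<comment> \<open>Nonemptiness of \<open>\<C>\<close> is what makes the enumeration have range
    exactly \<open>\<C>\<close>.\<close>
  moreover have "{} \<in> \<C>" by (auto simp: \<C>_def intro!: image_eqI[of _ _ "{}"])
  ultimately have range: "range (from_nat_into \<C>) = \<C>"
    by (intro range_from_nat_into) auto
  have "compact_base (from_nat_into \<C>)"
  proof
    fix i
    have "from_nat_into \<C> i \<in> \<C>" using range by blast
    then obtain F where F: "F \<subseteq> {B\<in>\<B>. compact (closure B)}" "finite F" "from_nat_into \<C> i = \<Union>F"
      by (auto simp: \<C>_def)
    show "open (from_nat_into \<C> i)"
      unfolding F(3) using F(1) topological_basis_open[OF \<B>(2)] by (intro open_Union) auto
    show "compact (closure (from_nat_into \<C> i))"
      unfolding F(3) closure_finite_Union[OF F(2)] using F(1,2) by (intro compact_UN) auto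
  next
    fix K W :: "'a set" assume K: "compact K" and W: "open W" "K \<subseteq> W"
    define \<D> where "\<D> = {B \<in> \<B>. compact (closure B) \<and> closure B \<subseteq> W}"
    have "K \<subseteq> \<Union>\<D>"
    proof
      fix x assume "x \<in> K"
      then obtain V where V: "open V" "compact (closure V)" "x \<in> V" "closure V \<subseteq> W"
        using nb W by blast
      then obtain B where B: "B \<in> \<B>" "x \<in> B" "B \<subseteq> V"
        using topological_basisE[OF \<B>(2)] by metis
      then have "closure B \<subseteq> closure V" by (simp add: closure_mono)
      then have "compact (closure B)"
        using V(2) by (metis compact_Int_closed closed_closure inf.absorb2)
      then show "x \<in> \<Union>\<D>" using B V \<open>closure B \<subseteq> closure V\<close> by (auto simp: \<D>_def)
    qed
    moreover have "open B" if "B \<in> \<D>" for B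
      using that topological_basis_open[OF \<B>(2)] by (auto simp: \<D>_def)
    ultimately obtain F where F: "F \<subseteq> \<D>" "finite F" "K \<subseteq> \<Union>F"
      using compactE[OF K] by metis
    then have "\<Union>F \<in> \<C>" by (auto simp: \<C>_def \<D>_def)
    then obtain i where "from_nat_into \<C> i = \<Union>F" using range by (metis imageE)
    moreover have "closure (\<Union>F) \<subseteq> W"
      unfolding closure_finite_Union[OF F(2)] using F(1) by (auto simp: \<D>_def)
    ultimately show "\<exists>i. K \<subseteq> from_nat_into \<C> i \<and> closure (from_nat_into \<C> i) \<subseteq> W"
      using F(3) by metis
  qed
  then show ?thesis by blast
qed

section \<open>The action and uniformly discrete sets\<close>

lemma mem_act: "x \<in> act g P \<longleftrightarrow> x + g \<in> P"
  unfolding act_def by (auto simp: image_iff algebra_simps intro!: bexI[of _ "x + g"])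

lemma act_act: "act g (act h P) = act (g + h) P"
  by (auto simp: mem_act add.assoc)

lemma act_zero [simp]: "act 0 P = P"
  by (auto simp: mem_act)

lemma act_eq_vimage: "act g P = (\<lambda>x. x + g) -` P"
  by (auto simp: mem_act)

lemma act_Int_empty_iff: "act g P \<inter> K = {} \<longleftrightarrow> P \<inter> (\<lambda>x. x + g) ` K = {}"
  by (auto simp: mem_act)

lemma continuous_on_translations:
  fixes g :: "'a::topological_group_add"
  shows "continuous_on UNIV (\<lambda>x. x + g)" "continuous_on UNIV (\<lambda>x. g + x)"
  by (intro continuous_intros)+

lemma closed_act: "closed P \<Longrightarrow> closed (act (g :: 'a::topological_group_add) P)"
  unfolding act_eq_vimage by (rule closed_vimage[OF _ continuous_on_translations(1)])

lemma open_act: "open P \<Longrightarrow> open (act (g :: 'a::topological_group_add) P)"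
  unfolding act_eq_vimage by (rule open_vimage[OF _ continuous_on_translations(1)])

lemma image_add_right_eq_act: "(\<lambda>x. x + g) ` K = act (- g :: 'a::group_add) K"
  by (simp add: act_def)

lemma compact_act:
  assumes "compact K"
  shows "compact (act (g :: 'a::topological_group_add) K)"
  using compact_continuous_image[OF continuous_on_subset[OF continuous_on_translations(1)] assms, of "- g"]
  by (simp add: act_def)

lemma continuous_map_act:
  "continuous_map chabauty_fell chabauty_fell (act (g :: 'a::topological_group_add))"
proof (rule continuous_map_into_chabauty_fell)
  fix Q :: "'a set" assume "Q \<in> topspace chabauty_fell"
  then show "closed (act g Q)" by (simp add: closed_act)
next
  fix K :: "'a set" assume "compact K"
  then have "compact ((\<lambda>x. x + g) ` K)"
    unfolding image_add_right_eq_act by (rule compact_act)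
  then show "openin chabauty_fell {Q \<in> topspace chabauty_fell. act g Q \<inter> K = {}}"
    using openin_miss by (simp add: act_Int_empty_iff)
next
  fix V :: "'a set" assume "open V"
  then have "open ((\<lambda>x. x + g) ` V)"
    unfolding image_add_right_eq_act by (rule open_act)
  then show "openin chabauty_fell {Q \<in> topspace chabauty_fell. act g Q \<inter> V \<noteq> {}}"
    using openin_hit by (simp add: act_Int_empty_iff)
qed

text \<open>Continuity maps the closure of the orbit into the closure of the translated orbit, which
  is again part of the orbit.\<close>

lemma act_punctured_hull:
  assumes "Q \<in> punctured_hull P"
  shows "act g Q \<in> punctured_hull P"
proof -
  have "act g Q \<in> act g ` (chabauty_fell closure_of range (\<lambda>h. act h P))"
    using assms by (auto simp: punctured_hull_def)
  also have "\<dots> \<subseteq> chabauty_fell closure_of act g ` range (\<lambda>h. act h P)"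
    by (rule continuous_map_image_closure_subset[OF continuous_map_act])
  also have "\<dots> \<subseteq> chabauty_fell closure_of range (\<lambda>h. act h P)"
    by (rule closure_of_mono) (auto simp: act_act)
  finally have "act g Q \<in> chabauty_fell closure_of range (\<lambda>h. act h P)" .
  moreover have "act g Q \<noteq> {}"
    using assms by (simp add: punctured_hull_def act_def)
  ultimately show ?thesis
    by (simp add: punctured_hull_def)
qed

lemma act_punctured_hull_iff: "act g Q \<in> punctured_hull P \<longleftrightarrow> Q \<in> punctured_hull P"
  using act_punctured_hull[of Q P g] act_punctured_hull[of "act g Q" P "- g"] by (auto simp: act_act)

lemma punctured_hull_subset: "punctured_hull P \<subseteq> {Q. closed Q}"
  using closure_of_subset_topspace[of chabauty_fell "range (\<lambda>h. act h P)"]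
  by (auto simp: punctured_hull_def)

text \<open>Removing the empty set amounts to intersecting the closed hull with the open set
  \<open>hit UNIV\<close>.\<close>

lemma sets_punctured_hull:
  fixes P :: "'a::topological_group_add set"
  shows "punctured_hull P \<in> sets (borel_of chabauty_fell)"
proof -
  let ?H = "chabauty_fell closure_of range (\<lambda>h. act h P)"
  have "punctured_hull P = ?H \<inter> hit UNIV"
    using closure_of_subset_topspace[of chabauty_fell "range (\<lambda>h. act h P)"]
    by (auto simp: punctured_hull_def)
  moreover have "?H \<in> sets (borel_of chabauty_fell)"
    by (intro closedin_borel_of) simp
  moreover have "(hit UNIV :: 'a set set) \<in> sets (borel_of chabauty_fell)"
    by (intro openin_borel_of openin_hit) simp
  ultimately show ?thesis by (simp only: sets.Int)
qed

text \<open>Continuity of \<open>x - y\<close> at \<open>(0, 0)\<close>.\<close>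

lemma symmetric_neighbourhood:
  fixes W :: "'a::topological_group_add set"
  assumes "open W" "0 \<in> W"
  obtains V where "open V" "0 \<in> V" "\<And>x y. x \<in> V \<Longrightarrow> y \<in> V \<Longrightarrow> x - y \<in> W"
proof -
  have "continuous_on UNIV (\<lambda>z :: 'a \<times> 'a. fst z + (- snd z))"
    by (intro continuous_intros)
  then have "open ((\<lambda>z :: 'a \<times> 'a. fst z + (- snd z)) -` W)"
    using assms(1) by (simp add: continuous_on_open_vimage)
  then obtain A B where AB: "open A" "open B" "(0, 0) \<in> A \<times> B" "A \<times> B \<subseteq> (\<lambda>z. fst z + (- snd z)) -` W"
    by (rule open_prod_elim[of _ "(0, 0)"]) (auto simp: assms(2))
  show thesis
  proof (rule that[of "A \<inter> B"])
    fix x y assume "x \<in> A \<inter> B" "y \<in> A \<inter> B"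
    then have "(x, y) \<in> (\<lambda>z. fst z + (- snd z)) -` W" using AB(4) by blast
    then show "x - y \<in> W" by simp
  qed (use AB in auto)
qed

lemma uniformly_discrete_gap:
  assumes "uniformly_discrete P"
  obtains W where "open W" "0 \<in> W" "\<And>p q. p \<in> P \<Longrightarrow> q \<in> P \<Longrightarrow> p - q \<in> W \<Longrightarrow> p = q"
proof -
  obtain W where W: "open W" "0 \<in> W" "\<not> (\<exists>y\<in>{p - q |p q. p \<in> P \<and> q \<in> P}. y \<in> W \<and> y \<noteq> 0)"
    using assms unfolding uniformly_discrete_def islimpt_def not_all not_imp by (elim exE conjE)
  show thesis
  proof (rule that[OF W(1,2)])
    fix p q assume "p \<in> P" "q \<in> P" "p - q \<in> W"
    then have "p - q = 0" using W(3) by blast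
    then show "p = q" by simp
  qed
qed

text \<open>A limit point outside \<open>P\<close> would have two distinct points of
  \<open>P\<close> in one translate of \<open>V\<close>, and their difference would lie in the gap
  \<open>W\<close>. Closedness makes \<open>P\<close> and its translates points of the Chabauty-Fell
  space.\<close>

lemma uniformly_discrete_closed:
  fixes P :: "'a::{topological_group_add, t2_space} set"
  assumes "uniformly_discrete P"
  shows "closed P"
proof -
  obtain W where W: "open W" "0 \<in> W" "\<And>p q. p \<in> P \<Longrightarrow> q \<in> P \<Longrightarrow> p - q \<in> W \<Longrightarrow> p = q"
    using uniformly_discrete_gap[OF assms] by blast
  obtain V where V: "open V" "0 \<in> V" "\<And>x y. x \<in> V \<Longrightarrow> y \<in> V \<Longrightarrow> x - y \<in> W"
    using symmetric_neighbourhood[OF W(1,2)] by blast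
  have "x \<in> P" if "x islimpt P" for x
  proof (rule ccontr)
    assume "x \<notin> P"
    have N: "open (act (- x) V)" "x \<in> act (- x) V"
      using V by (auto simp: open_act mem_act)
    obtain p where p: "p \<in> P" "p \<in> act (- x) V"
      by (rule islimptE[OF \<open>x islimpt P\<close> N(2,1)])
    \<comment> \<open>As \<open>x \<notin> P\<close>, deleting \<open>p\<close> leaves a
      neighbourhood of \<open>x\<close>, which supplies a second point of \<open>P\<close>.\<close>
    have "x \<in> act (- x) V - {p}" "open (act (- x) V - {p})"
      using N p \<open>x \<notin> P\<close> by (auto intro: open_delete)
    then obtain q where q: "q \<in> P" "q \<in> act (- x) V - {p}"
      by (rule islimptE[OF \<open>x islimpt P\<close>])
    have "(p + - x) - (q + - x) \<in> W"
      using p q by (intro V(3)) (auto simp: mem_act)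
    moreover have "(p + - x) - (q + - x) = p - q"
      by (simp add: algebra_simps)
    ultimately show False using W(3) p q by auto
  qed
  then show ?thesis by (simp add: closed_limpt)
qed

text \<open>Tube lemma: the pairs \<open>(g, x)\<close> with \<open>x + g \<notin> P\<close> form an
  open set, and \<open>K\<close> is compact. This makes the code of \<open>act g P\<close>
  measurable in \<open>g\<close>.\<close>

lemma open_orbit_miss:
  fixes P K :: "'a::{topological_group_add} set"
  assumes "closed P" "compact K"
  shows "open {g. act g P \<inter> K = {}}"
proof (subst open_subopen, safe)
  fix g assume g: "act g P \<inter> K = {}"
  have "continuous_on UNIV (\<lambda>z :: 'a \<times> 'a. snd z + fst z)"
    by (intro continuous_intros)
  then have W: "open ((\<lambda>z :: 'a \<times> 'a. snd z + fst z) -` (- P))"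
    using assms(1) by (simp only: continuous_on_open_vimage[OF open_UNIV] open_Compl Int_UNIV_right)
  have "{g} \<times> K \<subseteq> (\<lambda>z. snd z + fst z) -` (- P)"
    using g by (auto simp: mem_act)
  from Elementary_Topology.tube_lemma[OF assms(2) W this]
  obtain N where "g \<in> N" "open N" "N \<times> K \<subseteq> (\<lambda>z. snd z + fst z) -` (- P)"
    by (elim exE conjE)
  then show "\<exists>T. open T \<and> g \<in> T \<and> T \<subseteq> {g. act g P \<inter> K = {}}"
    by (intro exI[of _ N]) (auto simp: mem_act)
qed

section \<open>Haar measure and Folner averages\<close>

context
  fixes m :: "'a::{topological_group_add, second_countable_topology, t2_space} measure"
  assumes haar: "left_haar_measure m"
begin

lemma sets_haar [measurable_cong, simp]: "sets m = sets borel"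
  using haar by (simp add: left_haar_measure_def)

lemma haar_compact_finite: "compact K \<Longrightarrow> emeasure m K < \<infinity>"
  using haar by (simp add: left_haar_measure_def)

lemma haar_vimage_left:
  assumes "A \<in> sets borel"
  shows "(\<lambda>x. g + x) -` A \<in> sets borel" "emeasure m ((\<lambda>x. g + x) -` A) = emeasure m A"
proof -
  have b: "(\<lambda>x. g + x) \<in> borel_measurable borel"
    by (intro borel_measurable_continuous_onI continuous_on_translations)
  show "(\<lambda>x. g + x) -` A \<in> sets borel"
    using measurable_sets[OF b assms] by simp
  have "distr m borel (\<lambda>x. g + x) = m"
    using haar by (simp add: left_haar_measure_def)
  moreover have "space m = UNIV"
    using sets_eq_imp_space_eq[OF sets_haar] by simp
  ultimately show "emeasure m ((\<lambda>x. g + x) -` A) = emeasure m A"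
    using emeasure_distr[of "\<lambda>x. g + x" m borel A] b assms by (simp add: measurable_cong_sets[OF sets_haar])
qed

lemma haar_vimage_right:
  assumes "unimodular TYPE('a)" "A \<in> sets borel"
  shows "(\<lambda>x. x + g) -` A \<in> sets borel" "emeasure m ((\<lambda>x. x + g) -` A) = emeasure m A"
proof -
  have b: "(\<lambda>x. x + g) \<in> borel_measurable borel"
    by (intro borel_measurable_continuous_onI continuous_on_translations)
  show "(\<lambda>x. x + g) -` A \<in> sets borel"
    using measurable_sets[OF b assms(2)] by simp
  have "distr m borel (\<lambda>x. x + g) = m"
    using haar assms(1) by (simp add: unimodular_def)
  moreover have "space m = UNIV"
    using sets_eq_imp_space_eq[OF sets_haar] by simp
  ultimately show "emeasure m ((\<lambda>x. x + g) -` A) = emeasure m A"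
    using emeasure_distr[of "\<lambda>x. x + g" m borel A] b assms by (simp add: measurable_cong_sets[OF sets_haar])
qed

text \<open>By the Lindelof property countably many translates of \<open>V\<close> cover the group;
  if \<open>V\<close> were null, the whole group would be.\<close>

lemma haar_open_pos:
  assumes "open V" "V \<noteq> {}"
  shows "emeasure m V \<noteq> 0"
proof
  assume 0: "emeasure m V = 0"
  define \<F> where "\<F> = range (\<lambda>g. (\<lambda>x. g + x) -` V)"
  have op: "open S" if "S \<in> \<F>" for S
    using that continuous_on_translations(2) assms(1) by (auto simp: \<F>_def continuous_on_open_vimage)
  have null: "S \<in> null_sets m" if "S \<in> \<F>" for S
    using that haar_vimage_left[of V] assms(1) 0 by (auto simp: \<F>_def null_sets_def)
  obtain \<F>' where F': "\<F>' \<subseteq> \<F>" "countable \<F>'" "\<Union>\<F>' = \<Union>\<F>"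
    using Lindelof[of \<F>] op by metis
  obtain v where "v \<in> V" using assms(2) by blast
  then have "x \<in> (\<lambda>y. (v - x) + y) -` V" for x by simp
  then have "\<Union>\<F> = UNIV" unfolding \<F>_def by blast
  moreover have "(\<Union>S\<in>\<F>'. S) \<in> null_sets m"
    using F' null by (intro null_sets_UN') auto
  ultimately show False
    using F' haar by (simp add: left_haar_measure_def null_sets_def)
qed

end

lemma measure_haar_vimage_left:
  fixes m :: "'a::{topological_group_add, second_countable_topology, t2_space} measure"
  assumes "left_haar_measure m" "A \<in> sets borel"
  shows "measure m ((\<lambda>x. g + x) -` A) = measure m A"
  using haar_vimage_left(2)[OF assms] by (simp add: measure_def)

lemma folner_fmeasurable:
  fixes m :: "'a::{topological_group_add, second_countable_topology, t2_space} measure"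
  assumes "left_haar_measure m" "strong_folner_sequence m D"
  shows "D n \<in> sets borel" "D n \<in> fmeasurable m" "0 < measure m (D n)" "emeasure m (D n) \<noteq> 0" "emeasure m (D n) \<noteq> \<infinity>"
proof -
  have D: "D n \<in> sets borel" "compact (closure (D n))" "0 < emeasure m (D n)"
    using assms(2) by (auto simp: strong_folner_sequence_def)
  have "emeasure m (D n) \<le> emeasure m (closure (D n))"
    by (rule emeasure_mono[OF closure_subset]) (simp add: assms(1))
  also have "\<dots> < \<infinity>" by (rule haar_compact_finite[OF assms(1) D(2)])
  finally have fin: "emeasure m (D n) < \<infinity>" .
  show "D n \<in> sets borel" by (rule D)
  show "D n \<in> fmeasurable m" using D fin by (intro fmeasurableI) (simp_all add: assms(1))
  show "0 < measure m (D n)" using D fin by (simp add: measure_def enn2real_positive_iff)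
  show "emeasure m (D n) \<noteq> 0" "emeasure m (D n) \<noteq> \<infinity>" using D fin by auto
qed

text \<open>For \<open>C = {0, g}\<close> the product set is \<open>gD n \<union> D n\<close>, so
  the relative measure of \<open>D n - gD n\<close> tends to 0, while left invariance moves
  \<open>D n \<inter> {h. g + h \<in> B}\<close> to \<open>gD n \<inter> B\<close>. A one-sided
  bound suffices for invariance, because \<open>g\<close> may be replaced by
  \<open>- g\<close>.\<close>

lemma folner_shift:
  fixes m :: "'a::{topological_group_add, second_countable_topology, t2_space} measure"
  assumes haar: "left_haar_measure m" and folner: "strong_folner_sequence m D"
  obtains \<epsilon> :: "nat \<Rightarrow> real" where "\<epsilon> \<longlonglongrightarrow> 0"
    "\<And>n B. B \<in> sets borel \<Longrightarrow> measure (uniform_measure m (D n)) B \<le>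
       measure (uniform_measure m (D n)) {h. g + h \<in> B} + \<epsilon> n"
proof
  note F = folner_fmeasurable[OF haar folner]
  define gD where "gD n = (\<lambda>x. - g + x) -` D n" for n
  have gD: "gD n \<in> sets borel" "measure m (gD n) = measure m (D n)" "gD n \<in> fmeasurable m" for n
    using haar_vimage_left[OF haar F(1), of "- g" n] measure_haar_vimage_left[OF haar F(1), of "- g" n] F(2)[of n]
    by (auto simp: gD_def fmeasurable_def haar)
  \<comment> \<open>Since \<open>gD n\<close> and \<open>D n\<close> have equal measure,
    \<open>\<epsilon> n\<close> is the measure of \<open>D n - gD n\<close> relative to that of
    \<open>D n\<close>.\<close>
  define \<epsilon> where "\<epsilon> n = measure m (gD n \<union> D n) / measure m (D n) - 1" for n
  have set_eq: "{c + d |c d. c \<in> {0, g} \<and> d \<in> D n} = gD n \<union> D n" for n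
  proof (intro set_eqI iffI)
    fix x assume "x \<in> gD n \<union> D n"
    then show "x \<in> {c + d |c d. c \<in> {0, g} \<and> d \<in> D n}"
    proof
      assume "x \<in> gD n"
      then show ?thesis
        unfolding gD_def by (intro CollectI exI[of _ g] exI[of _ "- g + x"]) (simp add: add.assoc[symmetric])
    next
      assume "x \<in> D n"
      then show ?thesis by (intro CollectI exI[of _ 0] exI[of _ x]) simp
    qed
  qed (auto simp: gD_def add.assoc[symmetric])
  have completion: "measure (completion m) (gD n \<union> D n) = measure m (gD n \<union> D n)" for n
    using gD(1) F(1) by (intro measure_completion) (auto simp: haar)
  have "compact {0, g} \<and> {0, g} \<noteq> {}" by simp
  then have "(\<lambda>n. measure (completion m) {c + d |c d. c \<in> {0, g} \<and> d \<in> D n} / measure m (D n)) \<longlonglongrightarrow> 1"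
    using conjunct2[OF folner[unfolded strong_folner_sequence_def]] by iprover
  then have "(\<lambda>n. measure m (gD n \<union> D n) / measure m (D n)) \<longlonglongrightarrow> 1"
    unfolding set_eq completion .
  then show "\<epsilon> \<longlonglongrightarrow> 0"
    unfolding \<epsilon>_def using tendsto_diff[OF _ tendsto_const, of _ 1 sequentially 1] by fastforce
  fix n and B :: "'a set" assume B: "B \<in> sets borel"
  have B': "{h. g + h \<in> B} \<in> sets borel"
    using haar_vimage_left(1)[OF haar B, of g] by (simp add: vimage_def)
  have "(\<lambda>x. g + x) -` (gD n \<inter> B) = D n \<inter> {h. g + h \<in> B}"
    by (auto simp: gD_def add.assoc[symmetric])
  then have shift: "measure m (D n \<inter> {h. g + h \<in> B}) = measure m (gD n \<inter> B)"
    using measure_haar_vimage_left[OF haar, of "gD n \<inter> B" g] gD(1) B by simp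
  have fm: "A \<in> fmeasurable m" if "A \<subseteq> gD n \<union> D n" "A \<in> sets borel" for A
    by (rule fmeasurableI2[OF fmeasurable.Un[OF gD(3) F(2)] that(1)]) (simp add: that(2) haar)
  have "measure m (D n \<inter> B) \<le> measure m ((gD n \<inter> B) \<union> (D n - gD n))"
    using B gD(1)[of n] F(1)[of n] by (intro measure_mono_fmeasurable fm) (auto simp: haar)
  also have "\<dots> \<le> measure m (gD n \<inter> B) + measure m (D n - gD n)"
    using B gD(1)[of n] F(1)[of n] by (intro measure_Un_le) (auto simp: haar)
  also have "measure m (D n - gD n) = measure m (gD n \<union> D n) - measure m (D n)"
    using measure_Un2[OF gD(3) F(2), of n n] gD(2)[of n] by simp
  finally have "measure m (D n \<inter> B) / measure m (D n) \<le>
      (measure m (gD n \<inter> B) + (measure m (gD n \<union> D n) - measure m (D n))) / measure m (D n)"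
    using F(3)[of n] by (intro divide_right_mono) auto
  also have "\<dots> = measure m (gD n \<inter> B) / measure m (D n) + \<epsilon> n"
    using F(3)[of n] by (simp add: \<epsilon>_def add_divide_distrib diff_divide_distrib)
  finally show "measure (uniform_measure m (D n)) B \<le> measure (uniform_measure m (D n)) {h. g + h \<in> B} + \<epsilon> n"
    using B B' F(4,5)[of n] by (simp add: haar shift)
qed

section \<open>From upper density to the frequency of orbit hits\<close>

lemma frequently_density:
  assumes "upper_density m D P > 0"
  obtains a where "a > 0" "\<exists>\<^sub>F n in sequentially. real (card (P \<inter> D n)) / measure m (D n) > a"
proof -
  obtain a where a: "0 < ereal a" "ereal a < upper_density m D P"
    using ereal_dense2[OF assms] by blast
  have "\<exists>\<^sub>F n in sequentially. real (card (P \<inter> D n)) / measure m (D n) > a"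
  proof (rule ccontr)
    assume "\<not> ?thesis"
    then have "\<forall>\<^sub>F n in sequentially. ereal (real (card (P \<inter> D n)) / measure m (D n)) \<le> ereal a"
      by (simp add: not_frequently not_less)
    then have "upper_density m D P \<le> ereal a"
      unfolding upper_density_def by (rule Limsup_bounded)
    then show False using a by simp
  qed
  then show thesis using that a by simp
qed

text \<open>Packing argument. A point \<open>h = - c + p\<close> satisfies \<open>c + h = p\<close>,
  so \<open>c \<in> act h P\<close>: the translates of \<open>C'\<close> by points of
  \<open>P\<close> consist of hits. Those for \<open>p \<in> P \<inter> D n\<close> are disjoint,
  since a common point would put \<open>p - q = c - d\<close> into the gap, and they stay in
  \<open>S n\<close>, which is only slightly larger than \<open>D n\<close>.\<close>

lemma orbit_hits_frequently:
  fixes m :: "'a::{topological_group_add, second_countable_topology, t2_space} measure"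
  assumes haar: "left_haar_measure m" and folner: "strong_folner_sequence m D"
    and unimod: "unimodular TYPE('a)"
    and gap: "\<And>p q. p \<in> P \<Longrightarrow> q \<in> P \<Longrightarrow> p - q \<in> W \<Longrightarrow> p = q"
    and P: "closed P" and density: "upper_density m D P > 0"
    and C: "compact C" "\<And>x y. x \<in> C \<Longrightarrow> y \<in> C \<Longrightarrow> x - y \<in> W" "N \<subseteq> C" "open N" "0 \<in> N"
  obtains \<delta> where "\<delta> > 0"
    "\<exists>\<^sub>F n in sequentially. \<delta> \<le> measure (uniform_measure m (D n)) {h. act h P \<inter> C \<noteq> {}}"
proof -
  note F = folner_fmeasurable[OF haar folner]
  define C' where "C' = uminus ` C"
  have C': "compact C'"
    unfolding C'_def using C(1) by (intro compact_continuous_image continuous_intros)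
  \<comment> \<open>Inversion is an involution, so the image of \<open>N\<close> is also a preimage
    and hence open; this gives \<open>C'\<close> positive measure.\<close>
  have "uminus ` N = uminus -` N" by force
  then have "open (uminus ` N)"
    using open_vimage[OF C(4), of uminus] by (simp add: continuous_on_minus)
  then have "emeasure m (uminus ` N) \<noteq> 0"
    using haar_open_pos[OF haar] C(5) by blast
  moreover have "emeasure m (uminus ` N) \<le> emeasure m C'"
    unfolding C'_def using C(3) C' by (intro emeasure_mono image_mono) (auto simp: haar compact_imp_closed C'_def)
  ultimately have "0 < emeasure m C'" by (simp add: zero_less_iff_neq_zero) (metis le_zero_eq)
  then have "0 < measure m C'"
    using haar_compact_finite[OF haar C'] by (simp add: measure_def enn2real_positive_iff)
  have zero_C': "0 \<in> C'" using C(3,5) by (auto simp: C'_def image_iff intro!: bexI[of _ 0])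
  have translate: "\<exists>c\<in>C. x = - c + p \<and> p = c + x" if "x \<in> act (- p) C'" for x p
  proof -
    have "x - p \<in> uminus ` C" using that by (simp add: mem_act C'_def)
    then obtain c where c: "c \<in> C" "x - p = - c" by (elim imageE)
    then have "x = - c + p" by (simp add: diff_eq_eq)
    then show ?thesis using c(1) by (auto intro!: bexI[of _ c])
  qed
  define S where "S n = {c + d |c d. c \<in> C' \<and> d \<in> D n}" for n
  define \<rho> where "\<rho> n = measure (completion m) (S n) / measure m (D n)" for n
  have \<rho>: "\<rho> \<longlonglongrightarrow> 1"
    using folner C' zero_C' unfolding strong_folner_sequence_def \<rho>_def S_def by blast
  obtain a where a: "a > 0" "\<exists>\<^sub>F n in sequentially. real (card (P \<inter> D n)) / measure m (D n) > a"
    using frequently_density[OF density] by blast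
  \<comment> \<open>Relative to \<open>D n\<close> the translates have mass at least
    \<open>a * measure m C'\<close>. Half of it is kept as \<open>\<delta>\<close>; the other half
    pays for what sticks out of \<open>D n\<close> when
    \<open>\<rho> n < 1 + \<delta>\<close>.\<close>
  define \<delta> where "\<delta> = a * measure m C' / 2"
  have \<delta>: "\<delta> > 0" using a(1) \<open>0 < measure m C'\<close> by (simp add: \<delta>_def)
  have "\<forall>\<^sub>F n in sequentially. \<rho> n > 0 \<and> \<rho> n < 1 + \<delta>"
    using order_tendstoD(1)[OF \<rho>, of 0] order_tendstoD(2)[OF \<rho>, of "1 + \<delta>"] \<delta>
    by (auto intro: eventually_conj)
  from frequently_eventually_conj[OF a(2) this]
  have "\<exists>\<^sub>F n in sequentially. \<delta> \<le> measure (uniform_measure m (D n)) {h. act h P \<inter> C \<noteq> {}}"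
  proof (rule frequently_elim1, elim conjE)
    fix n assume card: "real (card (P \<inter> D n)) / measure m (D n) > a" and \<rho>n: "\<rho> n > 0" "\<rho> n < 1 + \<delta>"
    define H where "H = {h. act h P \<inter> C \<noteq> {}}"
    have "- H = {h. act h P \<inter> C = {}}" by (auto simp: H_def)
    then have "closed H"
      using open_orbit_miss[OF P C(1)] by (simp add: closed_def)
    then have H: "H \<in> sets borel" by simp
    \<comment> \<open>An infinite set has \<open>card\<close> 0, which the positive lower bound
      \<open>a\<close> excludes.\<close>
    have finite: "finite (P \<inter> D n)"
      using card a(1) by (cases "finite (P \<inter> D n)") auto
    define B where "B = (\<Union>p\<in>P \<inter> D n. act (- p) C')"
    have tr: "act (- p) C' \<in> sets borel" "measure m (act (- p) C') = measure m C'" "act (- p) C' \<in> fmeasurable m" for p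
      using haar_vimage_right[OF haar unimod, of C' "- p"] C' haar_compact_finite[OF haar C']
      by (auto simp: act_eq_vimage measure_def compact_imp_closed fmeasurable_def haar)
    have "disjoint_family_on (\<lambda>p. act (- p) C') (P \<inter> D n)"
      unfolding disjoint_family_on_def
    proof (intro ballI impI)
      fix p q assume pq: "p \<in> P \<inter> D n" "q \<in> P \<inter> D n" "p \<noteq> q"
      show "act (- p) C' \<inter> act (- q) C' = {}"
      proof (rule ccontr)
        assume "act (- p) C' \<inter> act (- q) C' \<noteq> {}"
        then obtain x c d where "c \<in> C" "d \<in> C" "p = c + x" "q = d + x"
          using translate[of _ p] translate[of _ q] by blast
        then have "p - q = c - d" by (simp add: diff_add_eq_diff_diff_swap)
        then show False using gap[of p q] C(2)[of c d] pq \<open>c \<in> C\<close> \<open>d \<in> C\<close> by simp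
      qed
    qed
    then have mB: "measure m B = real (card (P \<inter> D n)) * measure m C'"
      unfolding B_def using finite tr(1) fmeasurableD2[OF tr(3)]
      by (subst measure_finite_Union) (auto simp: haar tr(2))
    have B: "B \<in> fmeasurable m"
      unfolding B_def using finite tr(3) by (intro fmeasurable.finite_UN) auto
    have "B \<subseteq> H"
    proof
      fix x assume "x \<in> B"
      then obtain p where "p \<in> P" "x \<in> act (- p) C'" by (auto simp: B_def)
      then obtain c where "c \<in> C" "c \<in> act x P" using translate[of x p] by (auto simp: mem_act)
      then show "x \<in> H" by (auto simp: H_def)
    qed
    have "B \<subseteq> S n"
    proof
      fix x assume "x \<in> B"
      then obtain p where p: "p \<in> D n" "x \<in> act (- p) C'" by (auto simp: B_def)
      then obtain c where "c \<in> C" "x = - c + p" using translate[of x p] by auto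
      then show "x \<in> S n" using p(1) by (auto simp: S_def C'_def)
    qed
    have "D n \<subseteq> S n"
    proof
      fix x assume "x \<in> D n"
      then show "x \<in> S n"
        unfolding S_def using zero_C' by (intro CollectI exI[of _ 0] exI[of _ x]) simp
    qed
    \<comment> \<open>\<open>measure\<close> is 0 on nonmeasurable sets and on sets of infinite
      measure, so \<open>\<rho> n > 0\<close> shows that \<open>S n\<close> is measurable for the
      completion and has finite measure.\<close>
    have "measure (completion m) (S n) \<noteq> 0" using \<rho>n(1) by (auto simp: \<rho>_def)
    then have "S n \<in> fmeasurable (completion m)"
      using measure_notin_sets[of "S n" "completion m"]
      by (cases "emeasure (completion m) (S n) = \<infinity>") (auto simp: fmeasurable_def less_top measure_def)
    then have "measure (completion m) (D n \<union> B) \<le> measure (completion m) (S n)"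
      using \<open>B \<subseteq> S n\<close> \<open>D n \<subseteq> S n\<close> B F(2)[of n]
      by (intro measure_mono_fmeasurable) auto
    then have le: "measure m (D n \<union> B) \<le> measure (completion m) (S n)"
      using B F(2)[of n] by (simp add: fmeasurableD)
    have "measure m (D n \<union> B) = measure m (D n) + measure m B - measure m (D n \<inter> B)"
      by (rule measure_Un3[OF F(2) B])
    moreover have "measure m (D n \<inter> B) \<le> measure m (D n \<inter> H)"
    proof (rule measure_mono_fmeasurable)
      show "D n \<inter> B \<in> sets m"
        using fmeasurableD[OF B] fmeasurableD[OF F(2)] by (rule sets.Int[rotated])
      show "D n \<inter> H \<in> fmeasurable m"
        using F(1) H by (intro fmeasurableI2[OF F(2)]) (auto simp: haar)
    qed (use \<open>B \<subseteq> H\<close> in auto)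
    moreover have "measure (completion m) (S n) = \<rho> n * measure m (D n)"
      using F(3)[of n] by (simp add: \<rho>_def)
    moreover have "\<rho> n * measure m (D n) \<le> (1 + \<delta>) * measure m (D n)"
      using \<rho>n F(3)[of n] by (intro mult_right_mono) auto
    moreover have "a * measure m (D n) * measure m C' \<le> real (card (P \<inter> D n)) * measure m C'"
      using card F(3)[of n] \<open>0 < measure m C'\<close> by (intro mult_right_mono) (simp_all add: field_simps)
    moreover have "a * measure m (D n) * measure m C' = 2 * (\<delta> * measure m (D n))"
      by (simp add: \<delta>_def)
    ultimately have "\<delta> * measure m (D n) \<le> measure m (D n \<inter> H)"
      using le mB by (simp add: distrib_right)
    then have "\<delta> \<le> measure m (D n \<inter> H) / measure m (D n)"
      using F(3)[of n] by (simp add: field_simps)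
    then show "\<delta> \<le> measure (uniform_measure m (D n)) {h. act h P \<inter> C \<noteq> {}}"
      using F(4,5)[of n] H unfolding H_def[symmetric] by (simp add: haar)
  qed
  then show thesis using that \<delta> by blast
qed

section \<open>Decoding limits of codes\<close>

context compact_base
begin

text \<open>Each coherence condition involves finitely many coordinates, on which \<open>w\<close>
  agrees with a genuine code.\<close>

lemma coherentI_approx:
  assumes "\<And>J. finite J \<Longrightarrow> \<exists>Q\<in>R. \<forall>i\<in>J. w i = code Q i"
  shows "w \<in> coherent"
  unfolding coherent_def
proof (intro CollectI conjI allI impI)
  fix i
  obtain Q where "w i = code Q i" using assms[of "{i}"] by auto
  then show "w i = 0 \<or> w i = 1" using code_01 by simp
next
  fix J i
  assume J: "finite J" "closure (U i) \<subseteq> \<Union> (U ` J)" "\<forall>j\<in>J. w j = 0"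
  have "finite (insert i J)" using J(1) by simp
  then obtain Q where Q: "\<forall>j\<in>insert i J. w j = code Q j" using assms by blast
  then have "\<forall>j\<in>J. code Q j = 0" using J(3) by simp
  then show "w i = 0"
    using coherent_zero[OF code_coherent J(1,2)] Q by simp
qed

text \<open>In the product topology \<open>w\<close> lies in the closure of the codes of
  \<open>R\<close>; continuity of \<open>decode\<close> carries this over to the Chabauty-Fell
  space, where those codes become the members of \<open>R\<close>.\<close>

lemma decode_in_closure:
  assumes approx: "\<And>J. finite J \<Longrightarrow> \<exists>Q\<in>R. \<forall>i\<in>J. w i = code Q i"
    and closed: "\<And>Q. Q \<in> R \<Longrightarrow> closed Q"
  shows "decode w \<in> chabauty_fell closure_of R"
  unfolding in_closure_of
proof (intro conjI allI impI, goal_cases)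
  case 1
  show ?case by (simp add: closed_decode)
next
  case (2 T)
  have "openin (top_of_set coherent) {w \<in> coherent. decode w \<in> T}"
    using continuous_map_decode 2 by (auto simp: continuous_map_def)
  then obtain T' where T': "open T'" "{w \<in> coherent. decode w \<in> T} = coherent \<inter> T'"
    by (auto simp: openin_open)
  have "w \<in> {w \<in> coherent. decode w \<in> T}"
    using coherentI_approx[OF approx] 2 by simp
  then have "w \<in> T'" using T'(2) by blast
  moreover have "openin (product_topology (\<lambda>_. euclidean) UNIV) T'"
    using T'(1) by (simp add: euclidean_product_topology)
  ultimately obtain X where X: "w \<in> (\<Pi>\<^sub>E i\<in>UNIV. X i)" "finite {i. X i \<noteq> UNIV}" "(\<Pi>\<^sub>E i\<in>UNIV. X i) \<subseteq> T'"
    using product_topology_open_contains_basis[of "\<lambda>_. euclidean" UNIV T' w] by auto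
  obtain Q where Q: "Q \<in> R" "\<forall>i\<in>{i. X i \<noteq> UNIV}. w i = code Q i"
    using approx[OF X(2)] by blast
  have "code Q i \<in> X i" for i
  proof (cases "X i = UNIV")
    case False
    then have "code Q i = w i" using Q(2) by simp
    then show ?thesis using X(1) by (simp add: PiE_iff)
  qed simp
  then have "code Q \<in> (\<Pi>\<^sub>E i\<in>UNIV. X i)" by (simp add: PiE_iff)
  then have "code Q \<in> coherent \<inter> T'"
    using X(3) code_coherent by blast
  then have "decode (code Q) \<in> T"
    unfolding T'(2)[symmetric] by simp
  then show ?case
    using Q(1) decode_code[OF closed[OF Q(1)]] by auto
qed

lemma emeasure_decode:
  assumes "sets \<nu> = sets (Pi\<^sub>M UNIV (\<lambda>_. borel))" "A \<in> sets (borel_of chabauty_fell)"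
  shows "emeasure (distr (restrict_space \<nu> coherent) (borel_of chabauty_fell) decode) A
    = emeasure \<nu> {w \<in> coherent. decode w \<in> A}"
proof -
  have "sets (restrict_space \<nu> coherent) = sets (restrict_space (Pi\<^sub>M UNIV (\<lambda>_. borel)) coherent)"
    using assms(1) by (rule sets_restrict_space_cong)
  then have m: "decode \<in> measurable (restrict_space \<nu> coherent) (borel_of chabauty_fell)"
    using measurable_decode measurable_cong_sets by blast
  have sp: "space \<nu> = UNIV"
    using sets_eq_imp_space_eq[OF assms(1)] by (simp add: space_PiM)
  have "decode -` A \<inter> space (restrict_space \<nu> coherent) = {w \<in> coherent. decode w \<in> A}"
    by (auto simp: space_restrict_space sp)
  then show ?thesis
    unfolding emeasure_distr[OF m assms(2)]
    using sets_coherent assms(1) by (simp only:) (subst emeasure_restrict_space, auto simp: sp)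
qed

lemma measurable_level:
  assumes "sets \<nu> = sets (Pi\<^sub>M UNIV (\<lambda>_. borel :: real measure))"
  shows "{w. w i = c} \<in> sets \<nu>"
  using measurable_sets[OF measurable_component_singleton[of i UNIV "\<lambda>_. borel :: real measure"], of "{c}"]
  by (simp add: vimage_def space_PiM assms)

text \<open>The limit controls single coordinates. The events \<open>w i = 0\<close> with
  \<open>K \<subseteq> U i\<close> are directed: for finitely many of them interpolation gives a
  \<open>k\<close> whose event contains theirs on coherent sequences. Hence the measure of their
  union is a supremum over single coordinates.\<close>

lemma decode_miss_le:
  assumes sets: "sets \<nu> = sets (Pi\<^sub>M UNIV (\<lambda>_. borel))"
    and coh: "AE w in \<nu>. w \<in> coherent"
    and K: "compact K" and L: "compact L"
    and le: "\<And>k. K \<subseteq> U k \<Longrightarrow> \<exists>j. L \<subseteq> U j \<and> emeasure \<nu> {w. w k = 0} \<le> emeasure \<nu> {w. w j = 0}"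
  shows "emeasure \<nu> {w \<in> coherent. decode w \<inter> K = {}} \<le> emeasure \<nu> {w \<in> coherent. decode w \<inter> L = {}}"
proof -
  note level = measurable_level[OF sets]
  have coherent: "coherent \<in> sets \<nu>" using sets_coherent sets by simp
  have eq: "{w \<in> coherent. decode w \<inter> C = {}} = coherent \<inter> (\<Union>i\<in>{i. C \<subseteq> U i}. {w. w i = 0})"
    if "compact C" for C
    using decode_miss[OF _ that] by auto
  have meas: "{w \<in> coherent. decode w \<inter> C = {}} \<in> sets \<nu>" if "compact C" for C
    unfolding eq[OF that] using level coherent by (intro sets.Int sets.countable_UN') auto
  define A where "A n = coherent \<inter> (\<Union>i\<in>{i. K \<subseteq> U i \<and> i < n}. {w. w i = 0})" for n
  have A_meas: "A n \<in> sets \<nu>" for n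
    unfolding A_def using level coherent by (intro sets.Int sets.countable_UN') auto
  have "incseq A"
    unfolding A_def by (rule incseq_SucI) auto
  moreover have "(\<Union>n. A n) = {w \<in> coherent. decode w \<inter> K = {}}"
    unfolding eq[OF K] A_def by auto
  ultimately have SUP: "emeasure \<nu> {w \<in> coherent. decode w \<inter> K = {}} = (SUP n. emeasure \<nu> (A n))"
    using SUP_emeasure_incseq[of A \<nu>, OF image_subsetI[OF A_meas]] by simp
  show ?thesis
    unfolding SUP
  proof (rule SUP_least)
    fix n
    have "finite {i. K \<subseteq> U i \<and> i < n}" by simp
    \<comment> \<open>A finite intersection of open sets, the whole space if there are no indices,
      leaves room for one \<open>U k\<close> around \<open>K\<close>.\<close>
    then have "open (\<Inter>i\<in>{i. K \<subseteq> U i \<and> i < n}. U i)"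
      using open_U by (intro open_INT) auto
    then obtain k where k: "K \<subseteq> U k" "closure (U k) \<subseteq> (\<Inter>i\<in>{i. K \<subseteq> U i \<and> i < n}. U i)"
      using interpolate[OF K] by blast
    obtain j where j: "L \<subseteq> U j" "emeasure \<nu> {w. w k = 0} \<le> emeasure \<nu> {w. w j = 0}"
      using le[OF k(1)] by blast
    have "A n \<subseteq> {w. w k = 0}"
    proof
      fix w assume "w \<in> A n"
      then obtain i where "w \<in> coherent" "K \<subseteq> U i" "i < n" "w i = 0" by (auto simp: A_def)
      then show "w \<in> {w. w k = 0}"
        using coherent_zero[of w "{i}" k] k(2) by auto
    qed
    then have "emeasure \<nu> (A n) \<le> emeasure \<nu> {w. w k = 0}"
      by (rule emeasure_mono) (rule level)
    also note j(2)
    also have "emeasure \<nu> {w. w j = 0} \<le> emeasure \<nu> {w \<in> coherent. decode w \<inter> L = {}}"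
      using coh
    proof (rule emeasure_mono_AE[OF eventually_mono _])
      fix w assume "w \<in> coherent"
      then show "w \<in> {w. w j = 0} \<longrightarrow> w \<in> {w \<in> coherent. decode w \<inter> L = {}}"
        using decode_miss[of w L] L j(1) by auto
    qed (rule meas[OF L])
    finally show "emeasure \<nu> (A n) \<le> emeasure \<nu> {w \<in> coherent. decode w \<inter> L = {}}" .
  qed
qed

end

section \<open>The invariant measure\<close>

text \<open>Conditioning on the hull discards any mass at the empty set and preserves invariance,
  because each \<open>act g\<close> and its inverse map the hull to itself.\<close>

lemma measuredI:
  fixes P :: "'a::topological_group_add set"
  assumes sets: "sets M = sets (borel_of chabauty_fell)" and fin: "finite_measure M"
    and inv: "\<And>g. distr M M (act g) = M"
    and pos: "emeasure M (punctured_hull P) \<noteq> 0"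
  shows "measured P"
proof -
  let ?H = "punctured_hull P"
  \<comment> \<open>\<open>uniform_measure\<close> normalises by the mass of the hull;
    \<open>restrict_space\<close> then makes the hull the underlying space.\<close>
  define N where "N = restrict_space (uniform_measure M ?H) ?H"
  have H: "?H \<in> sets M" using sets_punctured_hull sets by simp
  have space: "space M = {Q. closed Q}"
    using sets_eq_imp_space_eq[OF sets] by simp
  have fin_H: "emeasure M ?H \<noteq> \<infinity>"
    using finite_measure.emeasure_finite[OF fin] by simp
  have sets_N: "sets N = sets (borel_of (subtopology chabauty_fell ?H))"
    unfolding sets_borel_of_subtopology[OF sets_punctured_hull] N_def
    by (rule sets_restrict_space_cong) (simp add: sets)
  have N: "A \<in> sets M" "A \<subseteq> ?H" "emeasure N A = emeasure M A / emeasure M ?H" if "A \<in> sets N" for A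
  proof -
    show A: "A \<in> sets M" "A \<subseteq> ?H"
      using that H by (auto simp: N_def sets_restrict_space)
    then show "emeasure N A = emeasure M A / emeasure M ?H"
      unfolding N_def using H by (subst emeasure_restrict_space) (auto simp: Int_absorb1)
  qed
  have space_N: "space N = ?H"
    using H sets.sets_into_space[OF H] by (auto simp: N_def space_restrict_space)
  have "prob_space N"
  proof (rule prob_spaceI)
    have "emeasure N (space N) = emeasure M ?H / emeasure M ?H"
      using N(3)[OF sets.top] space_N by simp
    then show "emeasure N (space N) = 1"
      using pos fin_H by (simp add: less_top)
  qed
  moreover have "act g \<in> measurable N N \<and> distr N N (act g) = N" for g
  proof
    have "continuous_map (subtopology chabauty_fell ?H) (subtopology chabauty_fell ?H) (act g)"
      using continuous_map_from_subtopology[OF continuous_map_act[of g], of ?H]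
      by (auto simp: continuous_map_in_subtopology act_punctured_hull)
    then show m: "act g \<in> measurable N N"
      using continuous_map_measurable_borel_of measurable_cong_sets[OF sets_N sets_N] by blast
    have mM: "act g \<in> measurable M M"
      using continuous_map_measurable_borel_of[OF continuous_map_act[of g]] measurable_cong_sets[OF sets sets] by blast
    show "distr N N (act g) = N"
    proof (rule measure_eqI)
      fix A assume "A \<in> sets (distr N N (act g))"
      then have A: "A \<in> sets N" by simp
      have "Q \<in> ?H" if "act g Q \<in> A" for Q
        using N(2)[OF A] that act_punctured_hull_iff[of g Q P] by blast
      then have "act g -` A \<inter> space N = act g -` A \<inter> space M"
        using punctured_hull_subset[of P] unfolding space_N space by blast
      then have "emeasure N (act g -` A \<inter> space N) = emeasure M (act g -` A \<inter> space M) / emeasure M ?H"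
        using N(3)[OF measurable_sets[OF m A]] by simp
      also have "emeasure M (act g -` A \<inter> space M) = emeasure M A"
        using emeasure_distr[OF mM N(1)[OF A]] inv[of g] by simp
      finally show "emeasure (distr N N (act g)) A = emeasure N A"
        using N(3)[OF A] emeasure_distr[OF m A] by simp
    qed simp
  qed
  ultimately show ?thesis
    unfolding measured_def using sets_N by blast
qed

theorem theorem7p27:
  fixes m :: "'a::{topological_group_add, second_countable_topology, t2_space} measure"
    and D :: "nat \<Rightarrow> 'a set"
    and P :: "'a set"
  assumes "locally_compact_space (euclidean :: 'a topology)"
    and "unimodular TYPE('a)"
    and "amenable TYPE('a)"
    and "left_haar_measure m"
    and "strong_folner_sequence m D"
    and "uniformly_discrete P"
    and "upper_density m D P > 0"
  shows "measured P"
proof -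
  note haar = assms(4) and folner = assms(5)
  have P: "closed P" using assms(6) by (rule uniformly_discrete_closed)
  obtain U :: "nat \<Rightarrow> 'a set" where "compact_base U"
    using compact_base_exists[OF assms(1)] by blast
  then interpret compact_base U .
  obtain W where W: "open W" "0 \<in> W" "\<And>p q. p \<in> P \<Longrightarrow> q \<in> P \<Longrightarrow> p - q \<in> W \<Longrightarrow> p = q"
    using uniformly_discrete_gap[OF assms(6)] by blast
  obtain V where V: "open V" "0 \<in> V" "\<And>x y. x \<in> V \<Longrightarrow> y \<in> V \<Longrightarrow> x - y \<in> W"
    using symmetric_neighbourhood[OF W(1,2)] by blast
  \<comment> \<open>\<open>closure (U i0)\<close> becomes the small compact neighbourhood of the
    packing argument: its differences lie in \<open>W\<close>.\<close>
  obtain i0 where i0: "0 \<in> U i0" "closure (U i0) \<subseteq> V"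
    using interpolate[of "{0}" V] V(1,2) by auto

  \<comment> \<open>Averages over the Folner sets and the limit of their codes\<close>
  define L where "L n = uniform_measure m (D n)" for n
  have prob_L: "prob_space (L n)" and sets_L: "sets (L n) = sets borel" for n
    using prob_space_uniform_measure[OF folner_fmeasurable(4,5)[OF haar folner]] haar
    by (auto simp: L_def)
  have C_W: "x - y \<in> W" if "x \<in> closure (U i0)" "y \<in> closure (U i0)" for x y
    using V(3) i0(2) that by blast
  obtain \<delta> where \<delta>: "\<delta> > 0" "\<exists>\<^sub>F n in sequentially. \<delta> \<le> measure (L n) {h. act h P \<inter> closure (U i0) \<noteq> {}}"
    using orbit_hits_frequently[OF haar folner assms(2) W(3) P assms(7) compact_closure_U C_W closure_subset open_U i0(1)]
    unfolding L_def by blast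
  define X where "X g = code (act g P)" for g
  have zero_set: "{g. X g i = 0} = {g. act g P \<inter> closure (U i) = {}}" for i
    by (auto simp: X_def code_def)
  have zero_borel: "{g. X g i = 0} \<in> sets borel" for i
    unfolding zero_set using open_orbit_miss[OF P compact_closure_U] by simp
  have X_meas: "(\<lambda>g. X g i) \<in> borel_measurable borel" for i
  proof -
    have "(\<lambda>g. X g i) = (\<lambda>g. if g \<in> {g. X g i = 0} then 0 else 1)"
      by (auto simp: X_def code_def)
    also have "\<dots> \<in> borel_measurable borel"
      using zero_borel by (intro measurable_If_set) auto
    finally show ?thesis .
  qed
  \<comment> \<open>The lower bound holds for infinitely many \<open>n\<close>; selecting these
    first lets it survive the further passage to a convergent subsequence.\<close>
  have "infinite {n. \<delta> \<le> measure (L n) {h. act h P \<inter> closure (U i0) \<noteq> {}}}"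
    using \<delta>(2) by (simp add: frequently_cofinite cofinite_eq_sequentially[symmetric])
  from infinite_enumerate[OF this]
  obtain s :: "nat \<Rightarrow> nat" where "strict_mono s" "\<forall>n. s n \<in> {n. \<delta> \<le> measure (L n) {h. act h P \<inter> closure (U i0) \<noteq> {}}}"
    by blast
  then have s: "strict_mono s" "\<delta> \<le> measure (L (s n)) {h. act h P \<inter> closure (U i0) \<noteq> {}}" for n
    by simp_all
  obtain r \<nu> where r: "strict_mono r" and \<nu>: "prob_space \<nu>"
    and sets_\<nu>: "sets \<nu> = sets (Pi\<^sub>M UNIV (\<lambda>_::nat. borel :: real measure))"
    and approx: "\<And>J. finite J \<Longrightarrow> AE w in \<nu>. \<exists>x\<in>space borel. \<forall>i\<in>J. w i = X x i"
    and limit: "\<And>i. (\<lambda>n. measure (L (s (r n))) {x \<in> space borel. X x i = 0}) \<longlonglongrightarrow> measure \<nu> {w. w i = 0}"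
    using cantor_compactness[of "\<lambda>n. L (s n)" borel X] prob_L sets_L X_meas code_01
    unfolding X_def by blast
  interpret \<nu>: prob_space \<nu> by (rule \<nu>)
  define t where "t n = s (r n)" for n
  have t: "strict_mono t" using s(1) r by (auto simp: t_def strict_mono_def)
  have limit: "(\<lambda>n. measure (L (t n)) {g. X g i = 0}) \<longlonglongrightarrow> measure \<nu> {w. w i = 0}" for i
    using limit[of i] by (simp add: t_def)
  \<comment> \<open>Lists enumerate the finite index sets countably, so one null set serves all of
    them.\<close>
  have "AE w in \<nu>. \<forall>xs. \<exists>g. \<forall>i\<in>set xs. w i = X g i"
    unfolding AE_all_countable using approx by simp
  then have AE: "AE w in \<nu>. w \<in> coherent \<and> decode w \<in> chabauty_fell closure_of range (\<lambda>g. act g P)"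
  proof eventually_elim
    fix w assume w: "\<forall>xs. \<exists>g. \<forall>i\<in>set xs. w i = X g i"
    have ap: "\<exists>Q\<in>range (\<lambda>g. act g P). \<forall>i\<in>J. w i = code Q i" if J: "finite J" for J
    proof -
      obtain xs where "set xs = J" using finite_list[OF J] by blast
      then obtain g where "\<forall>i\<in>J. w i = X g i" using w by blast
      then show ?thesis unfolding X_def by blast
    qed
    show "w \<in> coherent \<and> decode w \<in> chabauty_fell closure_of range (\<lambda>g. act g P)"
      using coherentI_approx[OF ap] decode_in_closure[OF ap] closed_act[OF P] by blast
  qed
  have coh: "AE w in \<nu>. w \<in> coherent" using AE by eventually_elim simp

  \<comment> \<open>Transport to the Chabauty-Fell space and invariance on miss sets\<close>
  define M where "M = distr (restrict_space \<nu> coherent) (borel_of chabauty_fell) decode"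
  have sets_M: "sets M = sets (borel_of chabauty_fell)" by (simp add: M_def)
  have emeasure_M: "emeasure M A = emeasure \<nu> {w \<in> coherent. decode w \<in> A}" if "A \<in> sets (borel_of chabauty_fell)" for A
    unfolding M_def by (rule emeasure_decode[OF sets_\<nu> that])
  have miss_M: "emeasure M (miss K) = emeasure \<nu> {w \<in> coherent. decode w \<inter> K = {}}" if "compact K" for K
    using emeasure_M[OF openin_borel_of[OF openin_miss[OF that]]] by (simp add: closed_decode)
  have shift_le: "emeasure M (miss K) \<le> emeasure M (miss (act (- g) K))" if K: "compact K" for K g
  proof -
    have gK: "compact (act (- g) K)" by (rule compact_act[OF K])
    show ?thesis
      unfolding miss_M[OF K] miss_M[OF gK]
    proof (rule decode_miss_le[OF sets_\<nu> coh K gK])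
      fix k assume k: "K \<subseteq> U k"
      have "act (- g) K \<subseteq> act (- g) (U k)" using k by (auto simp: mem_act)
      \<comment> \<open>Squeezing \<open>U j\<close> between the translates of \<open>K\<close> and
        \<open>U k\<close> turns a miss of \<open>closure (U k)\<close> by
        \<open>act (g + h) P\<close> into a miss of \<open>closure (U j)\<close> by
        \<open>act h P\<close>.\<close>
      then obtain j where j: "act (- g) K \<subseteq> U j" "closure (U j) \<subseteq> act (- g) (U k)"
        using interpolate[OF gK open_act[OF open_U]] by blast
      obtain \<epsilon> :: "nat \<Rightarrow> real" where \<epsilon>: "\<epsilon> \<longlonglongrightarrow> 0"
        "\<And>n B. B \<in> sets borel \<Longrightarrow> measure (L n) B \<le> measure (L n) {h. g + h \<in> B} + \<epsilon> n"
        using folner_shift[OF haar folner, of g] unfolding L_def by blast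
      have sub: "{h. g + h \<in> {h. X h k = 0}} \<subseteq> {h. X h j = 0}"
      proof
        fix h assume "h \<in> {h. g + h \<in> {h. X h k = 0}}"
        then have "act (g + h) P \<inter> closure (U k) = {}" using zero_set[of k] by auto
        then have "act h P \<inter> act (- g) (closure (U k)) = {}"
          unfolding act_act[symmetric] act_Int_empty_iff image_add_right_eq_act .
        moreover have "act (- g) (U k) \<subseteq> act (- g) (closure (U k))"
          using closure_subset[of "U k"] by (auto simp: mem_act)
        ultimately have "act h P \<inter> closure (U j) = {}" using j(2) by blast
        then show "h \<in> {h. X h j = 0}" using zero_set[of j] by blast
      qed
      have le: "measure (L n) {h. X h k = 0} \<le> measure (L n) {h. X h j = 0} + \<epsilon> n" for n
      proof -
        interpret prob_space "L n" by (rule prob_L)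
        have "measure (L n) {h. X h k = 0} \<le> measure (L n) {h. g + h \<in> {h. X h k = 0}} + \<epsilon> n"
          by (rule \<epsilon>(2)[OF zero_borel])
        also have "measure (L n) {h. g + h \<in> {h. X h k = 0}} \<le> measure (L n) {h. X h j = 0}"
          by (rule finite_measure_mono[OF sub]) (simp add: sets_L zero_borel)
        finally show ?thesis by simp
      qed
      \<comment> \<open>Along \<open>t\<close> both coordinate measures converge and the Folner
        error vanishes, so the inequality passes to \<open>\<nu>\<close>.\<close>
      have "(\<lambda>n. measure (L (t n)) {h. X h j = 0} + \<epsilon> (t n)) \<longlonglongrightarrow> measure \<nu> {w. w j = 0} + 0"
        using LIMSEQ_subseq_LIMSEQ[OF \<epsilon>(1) t] by (intro tendsto_add limit) (simp add: o_def)
      then have "measure \<nu> {w. w k = 0} \<le> measure \<nu> {w. w j = 0} + 0"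
        by (rule LIMSEQ_le[OF limit]) (auto intro: le)
      then show "\<exists>j. act (- g) K \<subseteq> U j \<and> emeasure \<nu> {w. w k = 0} \<le> emeasure \<nu> {w. w j = 0}"
        using j(1) by (intro exI[of _ j]) (simp add: \<nu>.emeasure_eq_measure)
    qed
  qed
  have shift_eq: "emeasure M (miss (act (- g) K)) = emeasure M (miss K)" if K: "compact K" for K g
  proof (rule antisym[OF _ shift_le[OF K]])
    have gK: "compact (act (- g) K)" by (rule compact_act[OF K])
    \<comment> \<open>The reverse inequality is the same estimate for \<open>- g\<close>, applied to
      the translated compact set.\<close>
    show "emeasure M (miss (act (- g) K)) \<le> emeasure M (miss K)"
      using shift_le[OF gK, of "- g"] by (simp add: act_act)
  qed
  have fin_M: "finite_measure M"
  proof (rule finite_measureI)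
    have "emeasure M (space M) = emeasure \<nu> {w \<in> coherent. decode w \<in> space (borel_of chabauty_fell)}"
      unfolding sets_eq_imp_space_eq[OF sets_M] by (rule emeasure_M) (rule sets.top)
    then show "emeasure M (space M) \<noteq> \<infinity>" by simp
  qed
  have space_M: "space M = {Q. closed Q}"
    using sets_eq_imp_space_eq[OF sets_M] by simp
  show "measured P"
  proof (rule measuredI[OF sets_M fin_M])
    fix g :: 'a
    have mM: "act g \<in> measurable M M"
      using continuous_map_measurable_borel_of[OF continuous_map_act[of g]] measurable_cong_sets[OF sets_M sets_M] by blast
    let ?E = "{miss K |K. compact (K :: 'a set)}"
    have "Int_stable ?E"
    proof (rule Int_stableI)
      fix A B assume "A \<in> ?E" "B \<in> ?E"
      then obtain K K' :: "'a set" where "compact K" "compact K'" "A = miss K" "B = miss K'" by blast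
      moreover have "miss K \<inter> miss K' = miss (K \<union> K')" for K K' :: "'a set" by auto
      ultimately show "A \<inter> B \<in> ?E" by (auto intro!: exI[of _ "K \<union> K'"])
    qed
    moreover have "?E \<subseteq> Pow {Q. closed Q}" by auto
    ultimately show "distr M M (act g) = M"
    \<comment> \<open>\<open>miss {}\<close> is the whole space, so a constant sequence exhausts it
      by a generator of finite measure.\<close>
    proof (rule measure_eqI_generator_eq[where A = "\<lambda>_. miss {}"])
      fix A assume "A \<in> ?E"
      then obtain K where K: "compact K" "A = miss K" by blast
      have "A \<in> sets M" using openin_borel_of[OF openin_miss[OF K(1)]] K(2) sets_M by simp
      then have "emeasure (distr M M (act g)) A = emeasure M (act g -` A \<inter> space M)"
        by (rule emeasure_distr[OF mM])
      also have "act g -` A \<inter> space M = miss (act (- g) K)"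
        by (auto simp: K(2) space_M closed_act act_Int_empty_iff image_add_right_eq_act)
      also have "emeasure M (miss (act (- g) K)) = emeasure M A"
        unfolding K(2) by (rule shift_eq[OF K(1)])
      finally show "emeasure (distr M M (act g)) A = emeasure M A" .
    next
      have "miss {} \<in> ?E" by (rule CollectI, rule exI[of _ "{}"]) simp
      then show "range (\<lambda>_. miss {}) \<subseteq> ?E" by blast
    next
      fix i :: nat
      show "emeasure (distr M M (act g)) (miss {}) \<noteq> \<infinity>"
        using finite_measure.emeasure_finite[OF finite_measure.finite_measure_distr[OF fin_M mM]] by simp
    qed (simp_all add: sets_M sets_borel_of_chabauty_fell)
  next

    \<comment> \<open>Positive mass of the punctured hull\<close>
    have level: "{w. w i0 = c} \<in> sets \<nu>" for c by (rule measurable_level[OF sets_\<nu>])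
    have "measure (L (t n)) {g. X g i0 = 0} \<le> 1 - \<delta>" for n
    proof -
      interpret prob_space "L (t n)" by (rule prob_L)
      have spL: "space (L (t n)) = UNIV" using sets_eq_imp_space_eq[OF sets_L] by simp
      have "{h. act h P \<inter> closure (U i0) \<noteq> {}} = space (L (t n)) - {g. X g i0 = 0}"
        by (auto simp: zero_set spL)
      then have "measure (L (t n)) {h. act h P \<inter> closure (U i0) \<noteq> {}} = 1 - measure (L (t n)) {g. X g i0 = 0}"
        using prob_compl[of "{g. X g i0 = 0}"] zero_borel sets_L by simp
      then show ?thesis using s(2)[of "r n"] by (simp add: t_def)
    qed
    \<comment> \<open>A bound on a single coordinate passes to the limit, and a coherent sequence
      with \<open>w i0 = 1\<close> never decodes to the empty set.\<close>
    then have "measure \<nu> {w. w i0 = 0} \<le> 1 - \<delta>"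
      by (intro LIMSEQ_le_const2[OF limit]) auto
    moreover have "measure \<nu> (space \<nu> - {w. w i0 = 0}) = 1 - measure \<nu> {w. w i0 = 0}"
      by (rule \<nu>.prob_compl[OF level])
    ultimately have "0 < measure \<nu> (space \<nu> - {w. w i0 = 0})" using \<delta>(1) by simp
    also have "\<dots> \<le> measure \<nu> {w \<in> coherent. decode w \<in> punctured_hull P}"
    proof (rule \<nu>.finite_measure_mono_AE)
      show "AE w in \<nu>. w \<in> space \<nu> - {w. w i0 = 0} \<longrightarrow> w \<in> {w \<in> coherent. decode w \<in> punctured_hull P}"
        using AE
      proof eventually_elim
        fix w assume w: "w \<in> coherent \<and> decode w \<in> chabauty_fell closure_of range (\<lambda>g. act g P)"
        show "w \<in> space \<nu> - {w. w i0 = 0} \<longrightarrow> w \<in> {w \<in> coherent. decode w \<in> punctured_hull P}"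
        proof
          assume "w \<in> space \<nu> - {w. w i0 = 0}"
          then have "w i0 = 1" using coherent_01[of w i0] w by auto
          then have "decode w \<noteq> {}" using decode_hit[of w UNIV] w by auto
          then show "w \<in> {w \<in> coherent. decode w \<in> punctured_hull P}"
            using w by (simp add: punctured_hull_def)
        qed
      qed
      have "decode -` punctured_hull P \<inter> space (restrict_space (Pi\<^sub>M UNIV (\<lambda>_. borel)) coherent)
          \<in> sets (restrict_space (Pi\<^sub>M UNIV (\<lambda>_. borel)) coherent)"
        by (rule measurable_sets[OF measurable_decode sets_punctured_hull])
      moreover have "decode -` punctured_hull P \<inter> space (restrict_space (Pi\<^sub>M UNIV (\<lambda>_. borel)) coherent)
          = {w \<in> coherent. decode w \<in> punctured_hull P}"
        by (auto simp: space_restrict_space space_PiM)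
      ultimately show "{w \<in> coherent. decode w \<in> punctured_hull P} \<in> sets \<nu>"
        using sets_coherent by (simp add: sets_restrict_space_iff sets_\<nu>)
    qed
    finally show "emeasure M (punctured_hull P) \<noteq> 0"
      unfolding emeasure_M[OF sets_punctured_hull] by (simp add: \<nu>.emeasure_eq_measure)
  qed
qed

end
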